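(* Let $\Gamma$ be an $(n,n-1,d)$-max-by-abelian graph. Then $A_{\Gamma}$ has the $R_\infty$-property.
   Context: A graph is a finite simple non-empty graph $\Gamma(V,E)$; it is complete if every two distinct vertices are joined by an edge, and regular if all vertices have the same degree. $\Delta(\Gamma)$ is the maximal degree of $\Gamma$, and $V_{\max}=\{v\in V\mid \deg(v)=\Delta(\Gamma)\}$. For $W\subseteq V$, $\Gamma(W)$ is the subgraph induced on $W$. $\Gamma$ is $(n,k,d)$-max-by-abelian (or $(n,k,d)$-MBA) if $\Gamma$ is non-regular and connected, $\Gamma(V\setminus V_{\max})$ is complete, and $|V|=n$, $|V_{\max}|=k$, $\Delta(\Gamma)=d$. The right-angled Artin group associated to $\Gamma$ is $A_\Gamma=\langle V \mid [v,w],\ vw\in E\rangle$. For a group $G$ and $\varphi\in\operatorname{Aut}(G)$, elements $x,y\in G$ are $\varphi$-conjugate if $x=gy\varphi(g)^{-1}$ for some $g\in G$; the Reidemeister number $R(\varphi)$ is the number of $\varphi$-conjugacy classes ($\infty$ if there are infinitely many). $G$ has the $R_\infty$-property if $R(\varphi)=\infty$ for all $\varphi\in\operatorname{Aut}(G)$. *)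

theory Defs
  imports
    "HOL-Algebra.Bij"
    "HOL-Library.Extended_Nat"
    "Graph_Theory.Graph_Theory"
begin

section \<open>Group presentations\<close>

text \<open>
  The letters \<open>(x, True)\<close> and \<open>(x, False)\<close> stand for the generator \<open>x\<close> and its formal inverse.
\<close>

type_synonym 'a word = "('a \<times> bool) list"

definition words :: "'a set \<Rightarrow> 'a word set" where
  "words X = lists (X \<times> UNIV)"

inductive pres_eq :: "'a set \<Rightarrow> 'a word set \<Rightarrow> 'a word \<Rightarrow> 'a word \<Rightarrow> bool"
  for X R where
  cancel: "u @ [(x, b), (x, \<not> b)] @ v \<in> words X \<Longrightarrow> pres_eq X R (u @ [(x, b), (x, \<not> b)] @ v) (u @ v)"
| relator: "u @ r @ v \<in> words X \<Longrightarrow> r \<in> R \<Longrightarrow> pres_eq X R (u @ r @ v) (u @ v)"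
| refl: "u \<in> words X \<Longrightarrow> pres_eq X R u u"
| sym: "pres_eq X R u v \<Longrightarrow> pres_eq X R v u"
| trans: "pres_eq X R u v \<Longrightarrow> pres_eq X R v w \<Longrightarrow> pres_eq X R u w"

definition pres_rel :: "'a set \<Rightarrow> 'a word set \<Rightarrow> ('a word \<times> 'a word) set" where
  "pres_rel X R = {(u, v). pres_eq X R u v}"

definition presented_group :: "'a set \<Rightarrow> 'a word set \<Rightarrow> 'a word set monoid" where
  "presented_group X R =
     \<lparr>carrier = words X // pres_rel X R,
      monoid.mult = (\<lambda>A B. \<Union>u\<in>A. \<Union>v\<in>B. pres_rel X R `` {u @ v}),
      one = pres_rel X R `` {[]}\<rparr>"

lemma words_append [simp]: "u @ v \<in> words X \<longleftrightarrow> u \<in> words X \<and> v \<in> words X"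
  by (auto simp: words_def)

lemma words_Nil [simp]: "[] \<in> words X"
  by (simp add: words_def)

lemma words_Cons [simp]: "p # u \<in> words X \<longleftrightarrow> fst p \<in> X \<and> u \<in> words X"
  by (cases p) (auto simp: words_def)

lemma pres_eq_words: "pres_eq X R u v \<Longrightarrow> u \<in> words X \<and> v \<in> words X"
  by (induction rule: pres_eq.induct) auto

lemma pres_eq_append_left:
  assumes "pres_eq X R u v" and "w \<in> words X"
  shows "pres_eq X R (w @ u) (w @ v)"
  using assms
proof (induction rule: pres_eq.induct)
  case (cancel u x b v)
  then show ?case using pres_eq.cancel[of "w @ u" x b v X R] by simp
next
  case (relator u r v)
  then show ?case using pres_eq.relator[of "w @ u" r v X R] by simp
next
  case (refl u)
  then show ?case by (simp add: pres_eq.refl)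
next
  case (sym u v)
  then show ?case by (simp add: pres_eq.sym)
next
  case (trans u v x)
  then show ?case by (blast intro: pres_eq.trans)
qed

lemma pres_eq_append_right:
  assumes "pres_eq X R u v" and "w \<in> words X"
  shows "pres_eq X R (u @ w) (v @ w)"
  using assms
proof (induction rule: pres_eq.induct)
  case (cancel u x b v)
  then show ?case using pres_eq.cancel[of u x b "v @ w" X R] by simp
next
  case (relator u r v)
  then show ?case using pres_eq.relator[of u r "v @ w" X R] by simp
next
  case (refl u)
  then show ?case by (simp add: pres_eq.refl)
next
  case (sym u v)
  then show ?case by (simp add: pres_eq.sym)
next
  case (trans u v x)
  then show ?case by (blast intro: pres_eq.trans)
qed

lemma pres_eq_append:
  assumes "pres_eq X R u u'" and "pres_eq X R v v'"
  shows "pres_eq X R (u @ v) (u' @ v')"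
proof (rule pres_eq.trans)
  show "pres_eq X R (u @ v) (u' @ v)"
    using assms pres_eq_words by (blast intro: pres_eq_append_right)
  show "pres_eq X R (u' @ v) (u' @ v')"
    using assms pres_eq_words by (blast intro: pres_eq_append_left)
qed

lemma equiv_pres_rel: "equiv (words X) (pres_rel X R)"
proof (rule equivI)
  show "pres_rel X R \<subseteq> words X \<times> words X"
    using pres_eq_words by (fastforce simp: pres_rel_def)
  show "refl_on (words X) (pres_rel X R)"
    by (simp add: refl_on_def pres_rel_def pres_eq.refl)
  show "sym (pres_rel X R)"
    by (simp add: sym_def pres_rel_def pres_eq.sym)
  show "trans (pres_rel X R)"
    unfolding trans_def pres_rel_def by (blast intro: pres_eq.trans)
qed

lemma pres_rel_Image_eq_iff:
  assumes "u \<in> words X" and "v \<in> words X"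
  shows "pres_rel X R `` {u} = pres_rel X R `` {v} \<longleftrightarrow> pres_eq X R u v"
  using eq_equiv_class_iff[OF equiv_pres_rel assms] by (simp add: pres_rel_def)

lemma mult_presented_group:
  assumes "u \<in> words X" and "v \<in> words X"
  shows "(pres_rel X R `` {u}) \<otimes>\<^bsub>presented_group X R\<^esub> (pres_rel X R `` {v}) = pres_rel X R `` {u @ v}"
proof -
  have "pres_rel X R `` {u' @ v'} = pres_rel X R `` {u @ v}"
    if "pres_eq X R u u'" "pres_eq X R v v'" for u' v'
    using pres_eq_append[OF that] pres_eq_words[OF that(1)] pres_eq_words[OF that(2)]
    by (simp add: pres_rel_Image_eq_iff pres_eq.sym)
  moreover have "pres_eq X R u u" "pres_eq X R v v"
    using assms by (auto intro: pres_eq.refl)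
  ultimately have "(\<Union>u'\<in>pres_rel X R `` {u}. \<Union>v'\<in>pres_rel X R `` {v}. pres_rel X R `` {u' @ v'}) =
      pres_rel X R `` {u @ v}"
    unfolding pres_rel_def by blast
  then show ?thesis
    by (simp add: presented_group_def)
qed

lemma pres_eq_formal_inverse:
  assumes "u \<in> words X"
  shows "pres_eq X R (rev (map (apsnd Not) u) @ u) []"
  using assms
proof (induction u)
  case Nil
  show ?case by (simp add: pres_eq.refl)
next
  case (Cons p u)
  obtain x b where p: "p = (x, b)" by fastforce
  let ?i = "rev (map (apsnd Not) u)"
  have i: "?i \<in> words X"
    using pres_eq_words[of X R "?i @ u" "[]"] Cons by simp
  have "pres_eq X R (?i @ [(x, \<not> b), (x, \<not> \<not> b)] @ u) (?i @ u)"
    using Cons.prems i p by (intro pres_eq.cancel) auto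
  then have "pres_eq X R (rev (map (apsnd Not) (p # u)) @ p # u) (?i @ u)"
    by (simp add: p)
  moreover have "pres_eq X R (?i @ u) []"
    using Cons by simp
  ultimately show ?case
    by (rule pres_eq.trans)
qed

theorem group_presented_group: "group (presented_group X R)"
proof (rule groupI)
  let ?G = "presented_group X R" and ?c = "\<lambda>u. pres_rel X R `` {u}"
  have carrier: "carrier ?G = ?c ` words X"
    by (auto simp: presented_group_def quotient_def)
  have one: "\<one>\<^bsub>?G\<^esub> = ?c []"
    by (simp add: presented_group_def)
  show "\<one>\<^bsub>?G\<^esub> \<in> carrier ?G"
    by (auto simp: carrier one)
  fix A assume "A \<in> carrier ?G"
  then obtain u where u: "u \<in> words X" "A = ?c u" by (auto simp: carrier)
  show "\<one>\<^bsub>?G\<^esub> \<otimes>\<^bsub>?G\<^esub> A = A"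
    using u by (simp add: one mult_presented_group)
  have inv: "pres_eq X R (rev (map (apsnd Not) u) @ u) []"
    using u(1) by (rule pres_eq_formal_inverse)
  have "rev (map (apsnd Not) u) \<in> words X"
    using pres_eq_words[OF inv] by simp
  with u inv show "\<exists>B\<in>carrier ?G. B \<otimes>\<^bsub>?G\<^esub> A = \<one>\<^bsub>?G\<^esub>"
    by (intro bexI[of _ "?c (rev (map (apsnd Not) u))"])
      (auto simp: carrier one mult_presented_group pres_rel_Image_eq_iff)
  fix B assume "B \<in> carrier ?G"
  then obtain v where v: "v \<in> words X" "B = ?c v" by (auto simp: carrier)
  show "A \<otimes>\<^bsub>?G\<^esub> B \<in> carrier ?G"
    using u v by (auto simp: carrier mult_presented_group)
  fix C assume "C \<in> carrier ?G"
  then obtain w where w: "w \<in> words X" "C = ?c w" by (auto simp: carrier)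
  show "A \<otimes>\<^bsub>?G\<^esub> B \<otimes>\<^bsub>?G\<^esub> C = A \<otimes>\<^bsub>?G\<^esub> (B \<otimes>\<^bsub>?G\<^esub> C)"
    using u v w by (simp add: mult_presented_group)
qed


section \<open>Twisted conjugacy\<close>

definition twisted_conj_rel :: "('a, 'b) monoid_scheme \<Rightarrow> ('a \<Rightarrow> 'a) \<Rightarrow> ('a \<times> 'a) set" where
  "twisted_conj_rel G \<phi> =
     {(x, y). x \<in> carrier G \<and> y \<in> carrier G \<and>
       (\<exists>g\<in>carrier G. x = g \<otimes>\<^bsub>G\<^esub> y \<otimes>\<^bsub>G\<^esub> inv\<^bsub>G\<^esub> (\<phi> g))}"

definition reidemeister_number :: "('a, 'b) monoid_scheme \<Rightarrow> ('a \<Rightarrow> 'a) \<Rightarrow> enat" where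
  "reidemeister_number G \<phi> =
     (let C = carrier G // twisted_conj_rel G \<phi> in if finite C then enat (card C) else \<infinity>)"

definition R_infinity_property :: "('a, 'b) monoid_scheme \<Rightarrow> bool" where
  "R_infinity_property G \<longleftrightarrow> (\<forall>\<phi>\<in>auto G. reidemeister_number G \<phi> = \<infinity>)"


section \<open>Graphs\<close>

text \<open>
  A finite simple graph is a \<^locale>\<open>graph\<close>: an edge \<open>{v, w}\<close> is a pair of opposite arcs, so the
  degree of a vertex is its out-degree. Non-emptiness is part of \<^const>\<open>connected\<close>.
\<close>

definition max_degree :: "('a, 'b) pre_digraph \<Rightarrow> nat" where
  "max_degree \<Gamma> = Max (out_degree \<Gamma> ` verts \<Gamma>)"

definition max_verts :: "('a, 'b) pre_digraph \<Rightarrow> 'a set" where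
  "max_verts \<Gamma> = {v \<in> verts \<Gamma>. out_degree \<Gamma> v = max_degree \<Gamma>}"

definition regular_graph :: "('a, 'b) pre_digraph \<Rightarrow> bool" where
  "regular_graph \<Gamma> \<longleftrightarrow> (\<forall>v\<in>verts \<Gamma>. \<forall>w\<in>verts \<Gamma>. out_degree \<Gamma> v = out_degree \<Gamma> w)"

definition complete_graph :: "('a, 'b) pre_digraph \<Rightarrow> bool" where
  "complete_graph \<Gamma> \<longleftrightarrow> complete_digraph (card (verts \<Gamma>)) \<Gamma>"

definition max_by_abelian :: "nat \<Rightarrow> nat \<Rightarrow> nat \<Rightarrow> ('a, 'b) pre_digraph \<Rightarrow> bool" where
  "max_by_abelian n k d \<Gamma> \<longleftrightarrow>
     graph \<Gamma> \<and> \<not> regular_graph \<Gamma> \<and> connected \<Gamma> \<and>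
     complete_graph (\<Gamma> \<restriction> (verts \<Gamma> - max_verts \<Gamma>)) \<and>
     card (verts \<Gamma>) = n \<and> card (max_verts \<Gamma>) = k \<and> max_degree \<Gamma> = d"


section \<open>Right-angled Artin groups\<close>

definition commutator_word :: "'a \<Rightarrow> 'a \<Rightarrow> 'a word" where
  "commutator_word v w = [(v, True), (w, True), (v, False), (w, False)]"

definition raag :: "('a, 'b) pre_digraph \<Rightarrow> 'a word set monoid" where
  "raag \<Gamma> = presented_group (verts \<Gamma>) {commutator_word v w |v w. v \<rightarrow>\<^bsub>\<Gamma>\<^esub> w}"

end

theory Submission
  imports
    Defs
    "HOL-Algebra.Generated_Groups"
    "HOL-Library.Z2"
    "HOL-Computational_Algebra.Polynomial"
    "HOL-Computational_Algebra.Formal_Power_Series"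
begin

text \<open>
  Let \<open>v0\<close> be the vertex of smaller degree; all other vertices have one and the same degree. The
  proof exhibits, for every automorphism and every number \<open>J\<close>, a finite quotient in which the
  automorphism fixes at least \<open>J\<close> central elements.

  This is enough: if \<open>f\<close> acts on a finite group \<open>Q\<close> and fixes \<open>J\<close> central elements, then
  \<open>g\<close> and \<open>z g\<close> move a point \<open>y\<close> to the same point \<open>g\<inverse> y f(g)\<close> for each of these \<open>z\<close>. So a
  twisted class has at most \<open>|Q| / J\<close> elements, and there are at least \<open>J\<close> classes
  (\<open>reidemeister_number_ge_card_central_fixed\<close>).

  \<^emph>\<open>What every automorphism preserves.\<close> Send each group element to its vector of exponent sums modulo 2.
  If \<open>g\<close> and \<open>h\<close> commute, their vectors \<open>x\<close> and \<open>y\<close> satisfy \<open>x\<^sub>v y\<^sub>w = x\<^sub>w y\<^sub>v\<close> whenever \<open>v\<close> and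
  \<open>w\<close> are not adjacent. Hence if \<open>u\<close> occurs in \<open>x\<close>, then \<open>y\<close> is determined by its entries at \<open>u\<close> and
  the neighbours of \<open>u\<close>. Counting centralizers gives \<open>deg v \<le> deg u\<close> for every \<open>u\<close> that occurs in the
  image of the generator \<open>v\<close>. So \<open>v0\<close> does not occur in the image of any other generator: the parity of the
  exponent of \<open>v0\<close> is invariant. The commutation of \<open>v0\<close> with its neighbours then shows
  that their images involve neighbours of \<open>v0\<close> only. Consequently the automorphisms act on the finite,
  non-empty set of those functions \<open>\<xi>\<close> from the vertices to \<open>\<int>/2\<close> that vanish on the neighbours of \<open>v0\<close> and
  take the value 1 at some \<^emph>\<open>far\<close> vertex, one that is neither \<open>v0\<close> nor adjacent to it
  (\<open>pullback_far_chars\<close>).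

  \<^emph>\<open>Fixed central elements.\<close> Each such \<open>\<xi>\<close> gives a homomorphism to the affine group of the ring of
  power series in \<open>T\<close> over \<open>\<int>/2[s]\<close>: the generator \<open>v\<close> acts by \<open>x \<mapsto> (1 + \<lambda>(v) T) x + \<mu>(v)\<close>, where
  \<open>\<mu>\<close> is the indicator function of \<open>v0\<close> and \<open>\<lambda> = \<xi> + s \<mu>\<close>. The translation part is the image of the
  Fox derivative with respect to \<open>v0\<close>. For \<open>n \<ge> 1\<close>, an iterated commutator of \<open>n + 1\<close> elements is a translation by a series
  of order at least \<open>n\<close>, and its coefficient at \<open>T\<^sup>n\<close> is a polynomial in the values
  of \<open>\<lambda>\<close> and \<open>\<mu>\<close> at these elements. So applying an automorphism \<open>f\<close> to the elements changes the coefficient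
  for \<open>\<xi>\<close> into the coefficient for \<open>\<xi> \<circ> f\<close>. An iterated commutator whose coefficient is
  the same for all \<open>\<xi>\<close> is therefore fixed by \<open>f\<close> modulo \<open>T\<^sup>n\<^sup>+\<^sup>1\<close>, where it is also central.

  Products of iterated commutators with coefficient \<open>(s\<^sup>2 + s)\<^sup>j\<close> for all \<open>\<xi>\<close> exist for every \<open>j\<close> and
  every large \<open>n\<close> (\<open>eventually_realizable_power\<close>). Two Boolean identities are behind this: the disjunction
  of the values of \<open>\<xi>\<close> at the far vertices is the constant 1, and
  \<open>(s + \<xi>(v0))\<^sup>2 + (s + \<xi>(v0)) = s\<^sup>2 + s\<close>. For \<open>j < J\<close> these are \<open>J\<close> different elements with a common
  \<open>n\<close>. They stay different, and become central and fixed, in the quotient by the elements all of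
  whose images under automorphisms are trivial modulo \<open>T\<^sup>n\<^sup>+\<^sup>1\<close> for all \<open>\<xi>\<close>; this quotient is finite
  (\<open>finite_index_characteristic_core\<close>).
\<close>

unbundle fps_syntax

text \<open>These rules rewrite \<^typ>\<open>bit\<close> arithmetic into bit operations, out of reach of ring identities.\<close>
declare add_bit_eq_xor [simp del] mult_bit_eq_and [simp del]

section \<open>Twisted classes in finite quotients\<close>

text \<open>
  The elements \<open>z g\<close> with \<open>z \<in> Z\<close> all move \<open>y\<close> to the same point, because \<open>p z\<close> is central and
  fixed. Choosing one \<open>g\<close> for each point of the class thus yields an injection from pairs to \<open>Q\<close>.
\<close>

lemma (in group) card_twisted_class_mult_le:
  assumes Q: "group Q" "finite (carrier Q)"
    and p: "p \<in> hom G Q" and f: "f \<in> hom G G"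
    and ker: "\<And>a b. a \<in> carrier G \<Longrightarrow> b \<in> carrier G \<Longrightarrow> p a = p b \<Longrightarrow> p (f a) = p (f b)"
    and Z: "Z \<subseteq> carrier G" "inj_on p Z"
    and central: "\<And>z a. z \<in> Z \<Longrightarrow> a \<in> carrier G \<Longrightarrow> p z \<otimes>\<^bsub>Q\<^esub> p a = p a \<otimes>\<^bsub>Q\<^esub> p z"
    and fixed: "\<And>z. z \<in> Z \<Longrightarrow> p (f z) = p z"
    and y: "y \<in> carrier G"
  shows "card (p ` {inv g \<otimes> y \<otimes> f g |g. g \<in> carrier G}) * card Z \<le> card (carrier Q)"
proof -
  interpret Q: group Q by fact
  interpret p: group_hom G Q p by unfold_locales (fact p)
  interpret f: group_hom G G f by unfold_locales (fact f)
  define T where "T = p ` {inv g \<otimes> y \<otimes> f g |g. g \<in> carrier G}"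
  have "\<forall>t\<in>T. \<exists>g\<in>carrier G. t = p (inv g \<otimes> y \<otimes> f g)"
    by (auto simp: T_def)
  then obtain g where g: "\<And>t. t \<in> T \<Longrightarrow> g t \<in> carrier G"
    and gt: "\<And>t. t \<in> T \<Longrightarrow> t = p (inv (g t) \<otimes> y \<otimes> f (g t))"
    by metis
  have "inj_on (\<lambda>(t, z). p (z \<otimes> g t)) (T \<times> Z)"
  proof (rule inj_onI, clarify)
    fix t z t' z'
    assume *: "t \<in> T" "z \<in> Z" "t' \<in> T" "z' \<in> Z" and eq: "p (z \<otimes> g t) = p (z' \<otimes> g t')"
    note c [simp] = g[OF *(1)] g[OF *(3)] subsetD[OF Z(1) *(2)] subsetD[OF Z(1) *(4)] y
    \<comment> \<open>The element \<open>u\<close> is central and fixed modulo the kernel and carries \<open>g t\<close> to \<open>g t'\<close>.\<close>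
    define u where "u = inv z' \<otimes> z"
    have u [simp]: "u \<in> carrier G" by (simp add: u_def)
    have "p (u \<otimes> g t) = inv\<^bsub>Q\<^esub> p z' \<otimes>\<^bsub>Q\<^esub> p (z \<otimes> g t)"
      by (simp add: u_def Q.m_assoc)
    also have "\<dots> = inv\<^bsub>Q\<^esub> p z' \<otimes>\<^bsub>Q\<^esub> p (z' \<otimes> g t')"
      by (simp only: eq)
    also have "\<dots> = p (g t')"
      by (simp add: Q.m_assoc[symmetric])
    finally have ug: "p (u \<otimes> g t) = p (g t')" .
    have fu: "p (f u) = p u"
      using fixed[OF *(2)] fixed[OF *(4)] by (simp add: u_def)
    have cu: "p u \<otimes>\<^bsub>Q\<^esub> p a = p a \<otimes>\<^bsub>Q\<^esub> p u" if [simp]: "a \<in> carrier G" for a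
    proof -
      have "inv\<^bsub>Q\<^esub> p z' \<otimes>\<^bsub>Q\<^esub> p a = p a \<otimes>\<^bsub>Q\<^esub> inv\<^bsub>Q\<^esub> p z'"
        using central[OF *(4), of a]
        by (metis Q.inv_solve_left Q.inv_solve_right Q.m_assoc Q.inv_closed Q.m_closed c(4) p.hom_closed that)
      then show ?thesis
        using central[OF *(2), of a] by (simp add: u_def Q.m_assoc) (simp flip: Q.m_assoc)
    qed
    have "t' = p (inv (g t') \<otimes> y \<otimes> f (g t'))" using gt * by blast
    also have "\<dots> = inv\<^bsub>Q\<^esub> p (g t') \<otimes>\<^bsub>Q\<^esub> p y \<otimes>\<^bsub>Q\<^esub> p (f (g t'))"
      by simp
    also have "\<dots> = inv\<^bsub>Q\<^esub> p (u \<otimes> g t) \<otimes>\<^bsub>Q\<^esub> p y \<otimes>\<^bsub>Q\<^esub> p (f (u \<otimes> g t))"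
      using ker[OF _ _ ug] ug by simp
    also have "\<dots> = inv\<^bsub>Q\<^esub> p (g t) \<otimes>\<^bsub>Q\<^esub> (inv\<^bsub>Q\<^esub> p u \<otimes>\<^bsub>Q\<^esub> p y \<otimes>\<^bsub>Q\<^esub> p u) \<otimes>\<^bsub>Q\<^esub> p (f (g t))"
      by (simp add: fu Q.inv_mult_group Q.m_assoc)
    also have "inv\<^bsub>Q\<^esub> p u \<otimes>\<^bsub>Q\<^esub> p y \<otimes>\<^bsub>Q\<^esub> p u = p y"
      using cu[of y] by (simp add: Q.m_assoc flip: cu) (simp flip: Q.m_assoc)
    also have "inv\<^bsub>Q\<^esub> p (g t) \<otimes>\<^bsub>Q\<^esub> p y \<otimes>\<^bsub>Q\<^esub> p (f (g t)) = p (inv (g t) \<otimes> y \<otimes> f (g t))"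
      by simp
    also have "\<dots> = t" using gt[OF *(1)] by simp
    finally have t: "t = t'" ..
    have "p z = p z'"
      using eq unfolding t by (simp add: g * )
    then show "t = t' \<and> z = z'"
      using t inj_onD[OF Z(2)] * by blast
  qed
  moreover have "(\<lambda>(t, z). p (z \<otimes> g t)) ` (T \<times> Z) \<subseteq> carrier Q"
    using g Z(1) by (auto intro!: p.hom_closed)
  ultimately have "card (T \<times> Z) \<le> card (carrier Q)"
    using Q(2) by (metis card_inj_on_le)
  then show ?thesis
    by (simp add: T_def card_cartesian_product)
qed

text \<open>
  The quotient is covered by the images of the twisted classes, each of which fills at most the fraction
  \<open>1 / card Z\<close> of it.
\<close>
lemma (in group) reidemeister_number_ge_card_central_fixed:
  assumes f: "f \<in> hom G G"
    and K: "K \<lhd> G" "finite (rcosets K)" "f ` K \<subseteq> K"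
    and Z: "Z \<subseteq> carrier G"
    and distinct: "\<And>z z'. z \<in> Z \<Longrightarrow> z' \<in> Z \<Longrightarrow> z \<otimes> inv z' \<in> K \<Longrightarrow> z = z'"
    and central: "\<And>z a. z \<in> Z \<Longrightarrow> a \<in> carrier G \<Longrightarrow> a \<otimes> z \<otimes> inv a \<otimes> inv z \<in> K"
    and fixed: "\<And>z. z \<in> Z \<Longrightarrow> f z \<otimes> inv z \<in> K"
  shows "enat (card Z) \<le> reidemeister_number G f"
proof -
  interpret K: normal K G by fact
  define Q where "Q = G Mod K"
  define p where "p a = K #> a" for a
  interpret Q: group Q unfolding Q_def by (rule K.factorgroup_is_group)
  have "p \<in> hom G Q"
    unfolding p_def Q_def by (rule K.r_coset_hom_Mod)
  then interpret p: group_hom G Q p by unfold_locales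
  interpret f: group_hom G G f by unfold_locales (fact f)
  have finQ: "finite (carrier Q)" using K by (simp add: Q_def FactGroup_def)
  have carQ: "carrier Q = p ` carrier G"
    by (auto simp: Q_def FactGroup_def RCOSETS_def p_def)
  have p_eq: "p a = p b \<longleftrightarrow> a \<otimes> inv b \<in> K" if "a \<in> carrier G" "b \<in> carrier G" for a b
    unfolding p_def using that K.subgroup_axioms
    by (metis K.rcos_module K.is_subgroup coset_join2 rcos_self repr_independence is_group)
  have ker: "p (f a) = p (f b)" if "a \<in> carrier G" "b \<in> carrier G" "p a = p b" for a b
  proof -
    have "f (a \<otimes> inv b) \<in> K" using that K(3) by (auto simp: p_eq)
    then show ?thesis using that by (simp add: p_eq)
  qed
  have cen: "p z \<otimes>\<^bsub>Q\<^esub> p a = p a \<otimes>\<^bsub>Q\<^esub> p z" if "z \<in> Z" "a \<in> carrier G" for z a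
  proof -
    have [simp]: "z \<in> carrier G" "a \<in> carrier G" using that Z by auto
    have "p (a \<otimes> z) = p (z \<otimes> a)"
      using central[OF that] by (simp add: p_eq inv_mult_group m_assoc del: p.hom_mult)
    then show ?thesis by simp
  qed
  have inj: "inj_on p Z"
    using Z distinct by (auto simp: inj_on_def p_eq subset_iff)
  have fx: "p (f z) = p z" if "z \<in> Z" for z
    using that Z fixed[OF that] by (auto simp: p_eq subset_iff)
  define C where "C = carrier G // twisted_conj_rel G f"
  have cls: "card (p ` A) * card Z \<le> card (carrier Q)" if "A \<in> C" for A
  proof -
    obtain y where y: "y \<in> carrier G" "A = twisted_conj_rel G f `` {y}"
      using \<open>A \<in> C\<close> by (auto simp: C_def quotient_def)
    have "A \<subseteq> {inv g \<otimes> y \<otimes> f g |g. g \<in> carrier G}"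
      unfolding y twisted_conj_rel_def
      by (auto simp: m_assoc) (metis (no_types, lifting) f.hom_closed inv_closed inv_solve_left inv_solve_right' m_assoc m_closed inv_equality l_inv r_inv r_one l_one)
    then have "card (p ` A) \<le> card (p ` {inv g \<otimes> y \<otimes> f g |g. g \<in> carrier G})"
      using y by (intro card_mono finite_subset[OF _ finQ]) auto
    also have "\<dots> * card Z \<le> card (carrier Q)"
      using card_twisted_class_mult_le[OF Q.is_group finQ p.homh f ker Z inj cen fx y(1)] .
    finally show ?thesis by simp
  qed
  have cover: "carrier Q = (\<Union>A\<in>C. p ` A)"
  proof -
    have "\<exists>A\<in>C. a \<in> A" if "a \<in> carrier G" for a
    proof -
      have "(a, a) \<in> twisted_conj_rel G f"
        using that by (auto simp: twisted_conj_rel_def intro!: bexI[of _ \<one>])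
      then show ?thesis using that by (auto simp: C_def quotient_def)
    qed
    moreover have "A \<subseteq> carrier G" if "A \<in> C" for A
      using that by (auto simp: C_def quotient_def twisted_conj_rel_def)
    ultimately have "\<Union>C = carrier G" by blast
    then show ?thesis unfolding carQ by (simp flip: image_Union)
  qed
  show ?thesis
  proof (cases "finite C")
    case True
    have "card (carrier Q) * card Z \<le> (\<Sum>A\<in>C. card (p ` A)) * card Z"
      unfolding cover by (intro mult_right_mono card_UN_le True) auto
    also have "\<dots> = (\<Sum>A\<in>C. card (p ` A) * card Z)"
      by (simp add: sum_distrib_right)
    also have "\<dots> \<le> (\<Sum>A\<in>C. card (carrier Q))"
      by (intro sum_mono cls)
    finally have "card (carrier Q) * card Z \<le> card (carrier Q) * card C" by simp
    moreover have "card (carrier Q) > 0"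
      using finQ Q.one_closed by (auto simp: card_gt_0_iff)
    ultimately have "card Z \<le> card C" by simp
    then show ?thesis
      using True by (simp add: reidemeister_number_def C_def Let_def)
  next
    case False
    then show ?thesis by (simp add: reidemeister_number_def C_def Let_def)
  qed
qed

section \<open>Automorphisms and characteristic subgroups of finite index\<close>

definition (in monoid) commutator where
  "commutator a b = a \<otimes> b \<otimes> inv a \<otimes> inv b"

lemma (in group) auto_hom_simps:
  assumes f: "f \<in> auto G"
  shows "a \<in> carrier G \<Longrightarrow> f a \<in> carrier G"
    and "a \<in> carrier G \<Longrightarrow> b \<in> carrier G \<Longrightarrow> f (a \<otimes> b) = f a \<otimes> f b"
    and "a \<in> carrier G \<Longrightarrow> f (inv a) = inv (f a)"
proof -
  interpret group_hom G G f by unfold_locales (use f in \<open>simp add: auto_def\<close>)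
  show "a \<in> carrier G \<Longrightarrow> f a \<in> carrier G"
    and "a \<in> carrier G \<Longrightarrow> b \<in> carrier G \<Longrightarrow> f (a \<otimes> b) = f a \<otimes> f b"
    and "a \<in> carrier G \<Longrightarrow> f (inv a) = inv (f a)"
    by simp_all
qed

lemma (in group) auto_commutator:
  assumes "f \<in> auto G" "a \<in> carrier G" "b \<in> carrier G"
  shows "f (commutator a b) = commutator (f a) (f b)"
  using assms by (simp add: commutator_def auto_hom_simps)

lemma (in group) auto_inverse:
  assumes f: "f \<in> auto G"
  shows "\<exists>h\<in>auto G. \<forall>a\<in>carrier G. h (f a) = a \<and> f (h a) = a"
proof (intro bexI ballI conjI)
  have b: "bij_betw f (carrier G) (carrier G)" using f by (simp add: auto_def Bij_def)
  let ?h = "restrict (inv_into (carrier G) f) (carrier G)"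
  show "?h \<in> auto G"
    using f by (auto simp: auto_def restrict_inv_into_hom restrict_inv_into_Bij)
  show "?h (f a) = a" if "a \<in> carrier G" for a
    using that auto_hom_simps(1)[OF f that] bij_betw_inv_into_left[OF b that] by simp
  show "f (?h a) = a" if "a \<in> carrier G" for a
    using that bij_betw_inv_into_right[OF b that] by simp
qed

lemma (in group) auto_compose:
  assumes f: "f \<in> auto G" and h: "h \<in> auto G"
  shows "compose (carrier G) f h \<in> auto G"
  using f h by (auto simp: auto_def hom_compose intro: compose_Bij)

text \<open>
  A congruence is given here by an invariant \<open>t\<close> that separates its classes, which spares
  a group structure on the values of \<open>t\<close>.
\<close>
lemma (in group) finite_congruence_normal:
  assumes cong: "\<And>a a' b b'. a \<in> carrier G \<Longrightarrow> a' \<in> carrier G \<Longrightarrow> b \<in> carrier G \<Longrightarrow> b' \<in> carrier G \<Longrightarrow>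
      t a = t a' \<Longrightarrow> t b = t b' \<Longrightarrow> t (a \<otimes> b) = t (a' \<otimes> b')"
    and fin: "finite (t ` carrier G)"
    and N_def: "N = {g \<in> carrier G. t g = t \<one>}"
  shows "N \<lhd> G" and "finite (rcosets N)"
    and "\<And>a b. a \<in> carrier G \<Longrightarrow> b \<in> carrier G \<Longrightarrow> a \<otimes> inv b \<in> N \<longleftrightarrow> t a = t b"
proof -
  have inv: "t (inv a) = t \<one>" if "a \<in> carrier G" "t a = t \<one>" for a
    using cong[of "inv a" "inv a" \<one> a] that by simp
  have "subgroup N G"
  proof (rule subgroupI)
    fix a b assume "a \<in> N" "b \<in> N"
    then show "a \<otimes> b \<in> N" using cong[of a \<one> b \<one>] by (auto simp: N_def)
  qed (auto simp: N_def inv)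
  moreover have "h \<otimes> a \<otimes> inv h \<in> N" if "a \<in> N" "h \<in> carrier G" for a h
    using that cong[of h h a \<one>] cong[of "h \<otimes> a" h "inv h" "inv h"] by (auto simp: N_def)
  ultimately show "N \<lhd> G" by (auto simp: normal_inv_iff)
  then interpret N: normal N G .
  show iff: "a \<otimes> inv b \<in> N \<longleftrightarrow> t a = t b" if [simp]: "a \<in> carrier G" "b \<in> carrier G" for a b
  proof
    assume "a \<otimes> inv b \<in> N"
    then have "t (a \<otimes> inv b) = t \<one>" unfolding N_def by blast
    then have "t (a \<otimes> inv b \<otimes> b) = t (\<one> \<otimes> b)" by (intro cong) simp_all
    then show "t a = t b" by (simp add: m_assoc)
  next
    assume "t a = t b"
    then have "t (a \<otimes> inv b) = t (b \<otimes> inv b)" by (intro cong) simp_all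
    then have "t (a \<otimes> inv b) = t \<one>" by simp
    then show "a \<otimes> inv b \<in> N" unfolding N_def by simp
  qed
  define k where "k s = N #> (SOME g. g \<in> carrier G \<and> t g = s)" for s
  have "N #> g = k (t g)" if g: "g \<in> carrier G" for g
  proof -
    let ?h = "SOME h. h \<in> carrier G \<and> t h = t g"
    have "?h \<in> carrier G \<and> t ?h = t g" by (rule someI[of _ g]) (use g in simp)
    then have h: "?h \<in> carrier G" and "t ?h = t g" by auto
    then have "?h \<otimes> inv g \<in> N" using iff[OF h g] by simp
    then have "?h \<in> N #> g" using N.rcos_module_rev[OF is_group g h] by simp
    then show ?thesis
      unfolding k_def using repr_independence[OF _ g N.is_subgroup] by blast
  qed
  then have "rcosets N \<subseteq> k ` t ` carrier G" by (auto simp: RCOSETS_def)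
  then show "finite (rcosets N)" using fin by (meson finite_imageI finite_subset)
qed

text \<open>
  The cosets \<open>N f(g)\<close>, one for each automorphism \<open>f\<close>, determine the coset \<open>K g\<close>. Only finitely many
  homomorphisms \<open>g \<mapsto> N f(g)\<close> to the finite group \<open>G / N\<close> occur, since each is determined by its values
  on the finite generating set.
\<close>
lemma (in group) finite_index_characteristic_core:
  assumes X: "finite X" "X \<subseteq> carrier G" "generate G X = carrier G"
    and N: "N \<lhd> G" "finite (rcosets N)"
    and K_def: "K = {g \<in> carrier G. \<forall>f\<in>auto G. f g \<in> N}"
  shows "K \<lhd> G" and "finite (rcosets K)"
    and "\<And>f. f \<in> auto G \<Longrightarrow> f ` K \<subseteq> K"
proof -
  interpret N: normal N G by fact
  define p where "p f = compose (carrier G) ((#>) N) f" for f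
  have p_app: "p f g = N #> f g" if "g \<in> carrier G" for f g
    using that by (simp add: p_def compose_def)
  let ?F = "p ` auto G"
  have phom: "group_hom G (G Mod N) (p f)" if "f \<in> auto G" for f
  proof -
    have "f \<in> hom G G" using that by (simp add: auto_def)
    then have "p f \<in> hom G (G Mod N)"
      unfolding p_def by (rule hom_compose[OF _ N.r_coset_hom_Mod])
    then show ?thesis
      using N.factorgroup_is_group by (simp add: group_hom_def group_hom_axioms_def is_group)
  qed
  have "inj_on (\<lambda>h. restrict h X) ?F"
  proof (rule inj_onI, clarify)
    fix f f' assume f: "f \<in> auto G" "f' \<in> auto G" and eq: "restrict (p f) X = restrict (p f') X"
    interpret p: group_hom G "G Mod N" "p f" by (rule phom[OF f(1)])
    interpret p': group_hom G "G Mod N" "p f'" by (rule phom[OF f(2)])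
    have "p f g = p f' g" if "g \<in> generate G X" for g
      using that
    proof (induction rule: generate.induct)
      case (incl h) then show ?case using eq by (metis restrict_apply')
    next
      case (inv h)
      then have "p f h = p f' h" using eq by (metis restrict_apply')
      then show ?case using inv X(2) by (metis p.hom_inv p'.hom_inv subsetD)
    next
      case (eng a b)
      then show ?case using X by simp
    qed simp
    then have "p f g = p f' g" if "g \<in> carrier G" for g using that X(3) by simp
    then show "p f = p f'"
      unfolding p_def by (intro extensionalityI[OF compose_extensional compose_extensional])
  qed
  moreover have "(\<lambda>h. restrict h X) ` ?F \<subseteq> X \<rightarrow>\<^sub>E rcosets N"
    using X(2) by (fastforce simp: p_app RCOSETS_def subset_iff intro: auto_hom_simps)
  ultimately have finF: "finite ?F"
    using X(1) N(2) by (meson finite_PiE finite_imageD finite_subset)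
  define t where "t g = (\<lambda>h\<in>?F. h g)" for g
  have t_eq: "t g = t g' \<longleftrightarrow> (\<forall>f\<in>auto G. p f g = p f g')" for g g'
    unfolding t_def by (auto simp: fun_eq_iff restrict_def)
  have cong: "t (a \<otimes> b) = t (a' \<otimes> b')"
    if "a \<in> carrier G" "a' \<in> carrier G" "b \<in> carrier G" "b' \<in> carrier G" "t a = t a'" "t b = t b'" for a a' b b'
    unfolding t_eq using that by (simp add: t_eq group_hom.hom_mult[OF phom])
  have fin: "finite (t ` carrier G)"
  proof (rule finite_subset)
    show "t ` carrier G \<subseteq> ?F \<rightarrow>\<^sub>E rcosets N"
      by (fastforce simp: t_def p_app RCOSETS_def subset_iff intro: auto_hom_simps)
  qed (use finF N(2) in \<open>simp add: finite_PiE\<close>)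
  have K_eq: "K = {g \<in> carrier G. t g = t \<one>}"
  proof -
    have "f g \<in> N \<longleftrightarrow> p f g = p f \<one>" if f: "f \<in> auto G" and g: "g \<in> carrier G" for f g
    proof -
      have "p f \<one> = N" using group_hom.hom_one[OF phom[OF f]] by (simp add: FactGroup_def)
      then show ?thesis
        using g auto_hom_simps(1)[OF f g] N.is_subgroup by (simp add: p_app) (metis coset_join1 N.rcos_const is_group N.subset)
    qed
    then show ?thesis unfolding K_def t_eq by blast
  qed
  show "K \<lhd> G" by (rule finite_congruence_normal(1)[OF cong fin K_eq])
  show "finite (rcosets K)" by (rule finite_congruence_normal(2)[OF cong fin K_eq])
  show "f ` K \<subseteq> K" if f: "f \<in> auto G" for f
  proof (rule image_subsetI)
    fix g assume g: "g \<in> K"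
    have "h (f g) \<in> N" if "h \<in> auto G" for h
    proof -
      have "compose (carrier G) h f g \<in> N" using g auto_compose[OF that f] unfolding K_def by blast
      then show ?thesis using g unfolding K_def by (simp add: compose_def)
    qed
    then show "f g \<in> K" using g auto_hom_simps(1)[OF f] unfolding K_def by blast
  qed
qed

section \<open>Affine transformations over power series\<close>

lemma bit_cases: "(b::bit) = 0 \<or> b = 1"
  by (cases b) auto

lemma finite_bit_poly_degree_le: "finite {p :: bit poly. degree p \<le> n}"
proof (rule finite_subset)
  show "{p :: bit poly. degree p \<le> n} \<subseteq> Poly ` {xs. set xs \<subseteq> {0, 1} \<and> length xs \<le> Suc n}"
  proof
    fix p :: "bit poly" assume "p \<in> {p. degree p \<le> n}"
    then have "length (coeffs p) \<le> Suc n" by (cases "p = 0") (auto simp: length_coeffs_degree)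
    then show "p \<in> Poly ` {xs. set xs \<subseteq> {0, 1} \<and> length xs \<le> Suc n}"
      using bit_cases by (intro image_eqI[of _ _ "coeffs p"]) auto
  qed
qed (simp add: finite_lists_length_le)

text \<open>
  Leading coefficients multiply: this is the only computation behind the step from an iterated commutator
  to the next one.
\<close>
lemma fps_mult_nth_low:
  fixes F H :: "'r::comm_ring_1 fps"
  assumes "F $ 0 = 0" and "\<And>i. i < n \<Longrightarrow> H $ i = 0"
  shows "i \<le> n \<Longrightarrow> (F * H) $ i = 0" and "(F * H) $ Suc n = F $ 1 * H $ n"
proof -
  show "(F * H) $ i = 0" if "i \<le> n"
    unfolding fps_mult_nth
  proof (intro sum.neutral ballI)
    fix j assume "j \<in> {0..i}"
    then show "F $ j * H $ (i - j) = 0"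
      using assms that by (cases "j = 0") auto
  qed
  have "F $ j * H $ (Suc n - j) = 0" if "j \<in> {0..Suc n} - {1}" for j
    using assms that by (cases "j = 0") auto
  then have "(\<Sum>j\<in>{0..Suc n}. F $ j * H $ (Suc n - j)) = (\<Sum>j\<in>{1}. F $ j * H $ (Suc n - j))"
    by (intro sum.mono_neutral_right) auto
  then show "(F * H) $ Suc n = F $ 1 * H $ n" by (simp add: fps_mult_nth)
qed

text \<open>
  The pair \<open>(a, b)\<close> stands for the map \<open>x \<mapsto> a x + b\<close>, and multiplication is composition.
\<close>
definition affine_mult :: "'r::comm_ring_1 \<times> 'r \<Rightarrow> 'r \<times> 'r \<Rightarrow> 'r \<times> 'r" where
  "affine_mult p q = (fst p * fst q, snd p + fst p * snd q)"

lemma affine_mult_assoc: "affine_mult (affine_mult p q) r = affine_mult p (affine_mult q r)"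
  by (simp add: affine_mult_def algebra_simps)

lemma affine_mult_one [simp]: "affine_mult (1, 0) p = p" "affine_mult p (1, 0) = p"
  by (simp_all add: affine_mult_def)

text \<open>
  The generator \<open>v\<close> acts by \<open>x \<mapsto> (1 + la(v) T) x + mu(v)\<close>. The geometric series for \<open>1 / (1 + la(v) T)\<close>
  describes the inverse over any commutative ring.
\<close>
definition affine_letter :: "('a \<Rightarrow> 'r::comm_ring_1) \<Rightarrow> ('a \<Rightarrow> 'r) \<Rightarrow> 'a \<times> bool \<Rightarrow> 'r fps \<times> 'r fps" where
  "affine_letter la mu p =
     (if snd p then (1 + fps_const (la (fst p)) * fps_X, fps_const (mu (fst p)))
      else (Abs_fps (\<lambda>n. (- la (fst p)) ^ n), - Abs_fps (\<lambda>n. (- la (fst p)) ^ n) * fps_const (mu (fst p))))"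

definition affine_eval :: "('a \<Rightarrow> 'r::comm_ring_1) \<Rightarrow> ('a \<Rightarrow> 'r) \<Rightarrow> 'a word \<Rightarrow> 'r fps \<times> 'r fps" where
  "affine_eval la mu u = foldr (\<lambda>p. affine_mult (affine_letter la mu p)) u (1, 0)"

lemma affine_eval_Nil [simp]: "affine_eval la mu [] = (1, 0)"
  by (simp add: affine_eval_def)

lemma affine_eval_Cons: "affine_eval la mu (p # u) = affine_mult (affine_letter la mu p) (affine_eval la mu u)"
  by (simp add: affine_eval_def)

lemma affine_eval_append:
  "affine_eval la mu (u @ v) = affine_mult (affine_eval la mu u) (affine_eval la mu v)"
  by (induction u) (simp_all add: affine_eval_Cons affine_mult_assoc)

lemma geometric_fps:
  fixes c :: "'r::comm_ring_1"
  shows "(1 + fps_const c * fps_X) * Abs_fps (\<lambda>n. (- c) ^ n) = 1"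
proof (rule fps_ext)
  fix n
  show "((1 + fps_const c * fps_X) * Abs_fps (\<lambda>n. (- c) ^ n)) $ n = 1 $ n"
    by (cases n) (simp_all add: distrib_right mult.assoc)
qed

lemma affine_eval_cancel: "affine_eval la mu [(x, b), (x, \<not> b)] = (1, 0)"
proof -
  have [simp]: "Abs_fps (\<lambda>n. (- la x) ^ n) * (1 + fps_const (la x) * fps_X) = 1"
    using geometric_fps[of "la x"] by (simp only: mult.commute)
  have "(1 + fps_const (la x) * fps_X) * (Abs_fps (\<lambda>n. (- la x) ^ n) * c) = c" for c
    using geometric_fps[of "la x"] by (simp flip: mult.assoc)
  then show ?thesis
    by (cases b) (simp_all add: affine_eval_Cons affine_letter_def affine_mult_def geometric_fps)
qed

text \<open>
  The two compositions of \<open>x \<mapsto> (1 + a T) x + b\<close> and \<open>x \<mapsto> (1 + c T) x + d\<close> have the same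
  multiplier, and their translation parts are \<open>b + d + a d T\<close> and \<open>b + d + c b T\<close>.
\<close>
lemma affine_eval_commutator:
  assumes "la v * mu w = la w * mu v"
  shows "affine_eval la mu (commutator_word v w) = (1, 0)"
proof -
  let ?e = "affine_eval la mu"
  have "fps_const (la v) * fps_const (mu w) = fps_const (la w) * fps_const (mu v)"
    using assms by simp
  then have "fps_X * (fps_const (la v) * fps_const (mu w)) = fps_X * (fps_const (la w) * fps_const (mu v))"
    by simp
  then have "?e [(v, True), (w, True)] = ?e [(w, True), (v, True)]"
    by (simp add: affine_eval_Cons affine_letter_def affine_mult_def algebra_simps
      del: fps_const_mult)
  then have "?e ([(v, True), (w, True)] @ [(v, False), (w, False)]) =
      ?e ([(w, True), (v, True)] @ [(v, False), (w, False)])"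
    by (simp only: affine_eval_append)
  also have "\<dots> = ?e ([(w, True)] @ [(v, True), (v, \<not> True)] @ [(w, \<not> True)])"
    by simp
  also have "\<dots> = ?e ([(w, True)] @ [(w, \<not> True)])"
    by (simp only: affine_eval_append affine_eval_cancel affine_mult_one)
  also have "\<dots> = ?e [(w, True), (w, \<not> True)]" by simp
  also have "\<dots> = (1, 0)" by (rule affine_eval_cancel)
  finally show ?thesis by (simp add: commutator_word_def)
qed

lemma fst_affine_eval_nth_0: "fst (affine_eval la mu u) $ 0 = 1"
  by (induction u) (auto simp: affine_eval_Cons affine_mult_def affine_letter_def)

text \<open>
  A bound on the degrees of coefficients: it leaves only finitely many truncations
  over a finite field, although the ring of polynomials is infinite.
\<close>
definition coeff_degree_le :: "('r::comm_ring_1) poly fps \<Rightarrow> bool" where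
  "coeff_degree_le F \<longleftrightarrow> (\<forall>n. degree (F $ n) \<le> n)"

lemma coeff_degree_le_mult:
  assumes "coeff_degree_le F" "coeff_degree_le H"
  shows "coeff_degree_le (F * H)"
  unfolding coeff_degree_le_def fps_mult_nth
proof (intro allI degree_sum_le)
  fix n i :: nat assume "i \<in> {0..n}"
  then have "degree (F $ i) + degree (H $ (n - i)) \<le> i + (n - i)"
    using assms by (intro add_mono) (auto simp: coeff_degree_le_def)
  with \<open>i \<in> {0..n}\<close> show "degree (F $ i * H $ (n - i)) \<le> n"
    by (intro order_trans[OF degree_mult_le]) simp
qed simp

lemma coeff_degree_le_add:
  "coeff_degree_le F \<Longrightarrow> coeff_degree_le H \<Longrightarrow> coeff_degree_le (F + H)"
  by (auto simp: coeff_degree_le_def intro: degree_add_le)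

lemma coeff_degree_le_uminus: "coeff_degree_le F \<Longrightarrow> coeff_degree_le (- F)"
  by (simp add: coeff_degree_le_def)

lemma coeff_degree_le_affine_eval:
  assumes la: "\<And>v. degree (la v) \<le> 1" and mu: "\<And>v. degree (mu v) = 0"
  shows "coeff_degree_le (fst (affine_eval la mu u)) \<and> coeff_degree_le (snd (affine_eval la mu u))"
proof (induction u)
  case Nil
  show ?case by (simp add: coeff_degree_le_def fps_one_nth)
next
  case (Cons p u)
  have const: "coeff_degree_le (fps_const (mu v))" for v
    by (simp add: coeff_degree_le_def mu)
  have "coeff_degree_le (1 + fps_const (la v) * fps_X)" for v
    unfolding coeff_degree_le_def
  proof
    fix n show "degree ((1 + fps_const (la v) * fps_X) $ n) \<le> n"
      using la[of v] by (cases n; cases "n = 1") (auto simp: fps_X_def)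
  qed
  moreover have geo: "coeff_degree_le (Abs_fps (\<lambda>n. (- la v) ^ n))" for v
    unfolding coeff_degree_le_def
  proof
    fix n
    have "degree ((- la v) ^ n) \<le> degree (- la v) * n" by (rule degree_power_le)
    also have "\<dots> \<le> 1 * n" using la[of v] by (intro mult_right_mono) auto
    finally show "degree (Abs_fps (\<lambda>n. (- la v) ^ n) $ n) \<le> n" by simp
  qed
  moreover have "coeff_degree_le (- Abs_fps (\<lambda>n. (- la v) ^ n) * fps_const (mu v))" for v
    using coeff_degree_le_mult[OF geo const, of v v]
    unfolding minus_mult_left[symmetric] by (rule coeff_degree_le_uminus)
  ultimately have "coeff_degree_le (fst (affine_letter la mu p))" "coeff_degree_le (snd (affine_letter la mu p))"
    using const by (simp_all only: affine_letter_def fst_conv snd_conv split: if_split) simp_all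
  then show ?case
    using Cons by (simp add: affine_eval_Cons affine_mult_def coeff_degree_le_mult coeff_degree_le_add)
qed

section \<open>Homomorphisms from a right-angled Artin group\<close>

locale raag_graph = graph \<Gamma> for \<Gamma> :: "('a, 'b) pre_digraph" (structure)
begin

abbreviation V where "V \<equiv> verts \<Gamma>"
abbreviation R where "R \<equiv> {commutator_word v w |v w. v \<rightarrow> w}"
abbreviation G where "G \<equiv> raag \<Gamma>"
abbreviation cls where "cls u \<equiv> pres_rel V R `` {u}"
abbreviation gen where "gen v \<equiv> cls [(v, True)]"

sublocale G: group G
  unfolding raag_def by (rule group_presented_group)

lemma carrier_raag: "carrier G = cls ` words V"
  by (auto simp: raag_def presented_group_def quotient_def)

lemma cls_carrier [simp]: "u \<in> words V \<Longrightarrow> cls u \<in> carrier G"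
  by (auto simp: carrier_raag)

lemma gen_carrier [simp]: "v \<in> V \<Longrightarrow> gen v \<in> carrier G"
  by simp

lemma cls_append: "u \<in> words V \<Longrightarrow> v \<in> words V \<Longrightarrow> cls (u @ v) = cls u \<otimes>\<^bsub>G\<^esub> cls v"
  by (simp add: raag_def mult_presented_group)

lemma one_raag: "\<one>\<^bsub>G\<^esub> = cls []"
  by (simp add: raag_def presented_group_def)

lemma cls_eq: "pres_eq V R u v \<Longrightarrow> cls u = cls v"
  using pres_eq_words[of V R u v] by (simp add: pres_rel_Image_eq_iff)

lemma inv_gen: "v \<in> V \<Longrightarrow> cls [(v, False)] = inv\<^bsub>G\<^esub> gen v"
  using pres_eq.cancel[of "[]" v False "[]" V R]
  by (intro G.inv_equality[symmetric]) (auto simp: one_raag cls_append[symmetric] intro!: cls_eq)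

lemma generate_gen: "generate G (gen ` V) = carrier G"
proof
  show "generate G (gen ` V) \<subseteq> carrier G"
    by (rule G.generate_incl) auto
  have "cls u \<in> generate G (gen ` V)" if "u \<in> words V" for u
    using that
  proof (induction u)
    case Nil
    show ?case using generate.one[of G] by (simp add: one_raag)
  next
    case (Cons p u)
    obtain v b where p: "p = (v, b)" by fastforce
    have v: "v \<in> V" using Cons p by simp
    then have "cls [p] \<in> generate G (gen ` V)"
      by (cases b) (auto simp: p inv_gen intro: generate.incl generate.inv)
    moreover have "cls (p # u) = cls [p] \<otimes>\<^bsub>G\<^esub> cls u"
      using cls_append[of "[p]" u] Cons.prems by simp
    ultimately show ?case using Cons by (simp add: generate.eng)
  qed
  then show "carrier G \<subseteq> generate G (gen ` V)" by (auto simp: carrier_raag)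
qed

lemma gen_commute:
  assumes "v \<rightarrow> w"
  shows "gen v \<otimes>\<^bsub>G\<^esub> gen w = gen w \<otimes>\<^bsub>G\<^esub> gen v"
proof -
  have [simp]: "v \<in> V" "w \<in> V" using adj_in_verts[OF assms] by auto
  have "commutator_word v w \<in> R" "commutator_word v w \<in> words V"
    using assms by (auto simp: commutator_word_def)
  then have "pres_eq V R ([] @ commutator_word v w @ []) ([] @ [])"
    by (intro pres_eq.relator) simp_all
  then have "cls (commutator_word v w) = \<one>\<^bsub>G\<^esub>"
    unfolding one_raag by (intro cls_eq) simp
  moreover have "cls (commutator_word v w) =
      gen v \<otimes>\<^bsub>G\<^esub> gen w \<otimes>\<^bsub>G\<^esub> inv\<^bsub>G\<^esub> gen v \<otimes>\<^bsub>G\<^esub> inv\<^bsub>G\<^esub> gen w"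
  proof -
    have "commutator_word v w = [(v, True)] @ [(w, True)] @ [(v, False)] @ [(w, False)]"
      by (simp add: commutator_word_def)
    then have "cls (commutator_word v w) = gen v \<otimes>\<^bsub>G\<^esub> (gen w \<otimes>\<^bsub>G\<^esub> (cls [(v, False)] \<otimes>\<^bsub>G\<^esub> cls [(w, False)]))"
      by (simp only: cls_append words_append words_Cons words_Nil fst_conv \<open>v \<in> V\<close> \<open>w \<in> V\<close> simp_thms)
    then show ?thesis
      by (simp only: inv_gen G.m_assoc gen_carrier G.inv_closed G.m_closed \<open>v \<in> V\<close> \<open>w \<in> V\<close>)
  qed
  ultimately have "gen v \<otimes>\<^bsub>G\<^esub> gen w = inv\<^bsub>G\<^esub> (inv\<^bsub>G\<^esub> gen v \<otimes>\<^bsub>G\<^esub> inv\<^bsub>G\<^esub> gen w)"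
    by (intro G.inv_equality[symmetric]) (simp_all add: G.m_assoc del: G.inv_mult_group)
  then show ?thesis by (simp add: G.inv_mult_group)
qed

text \<open>
  The choice of a representative is harmless for functions that are constant on classes.
\<close>
definition lift :: "('a word \<Rightarrow> 'c) \<Rightarrow> 'a word set \<Rightarrow> 'c" where
  "lift f A = f (SOME u. u \<in> A)"

lemma lift_cls:
  assumes "u \<in> words V" and "\<And>u v. pres_eq V R u v \<Longrightarrow> f u = f v"
  shows "lift f (cls u) = f u"
proof -
  have "u \<in> cls u" using assms(1) by (simp add: pres_rel_def pres_eq.refl)
  then have "(SOME v. v \<in> cls u) \<in> cls u" by (rule someI)
  then have "pres_eq V R u (SOME v. v \<in> cls u)" by (simp add: pres_rel_def)
  then show ?thesis using assms(2) by (simp add: lift_def)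
qed

definition parity :: "'a \<Rightarrow> 'a word set \<Rightarrow> bit" where
  "parity v = lift (\<lambda>u. of_nat (length (filter (\<lambda>p. fst p = v) u)))"

lemma parity_cls:
  assumes "u \<in> words V"
  shows "parity v (cls u) = of_nat (length (filter (\<lambda>p. fst p = v) u))"
  unfolding parity_def
proof (rule lift_cls[OF assms])
  show "of_nat (length (filter (\<lambda>p. fst p = v) u)) = (of_nat (length (filter (\<lambda>p. fst p = v) u')) :: bit)"
    if "pres_eq V R u u'" for u u'
    using that by (induction rule: pres_eq.induct) (auto simp: commutator_word_def)
qed

lemma parity_gen: "w \<in> V \<Longrightarrow> parity v (gen w) = of_bool (v = w)"
  by (auto simp: parity_cls)

lemma parity_mult:
  assumes "g \<in> carrier G" "h \<in> carrier G"
  shows "parity v (g \<otimes>\<^bsub>G\<^esub> h) = parity v g + parity v h"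
  using assms by (auto simp: carrier_raag parity_cls simp flip: cls_append)

definition affine_rep :: "('a \<Rightarrow> 'r::comm_ring_1) \<Rightarrow> ('a \<Rightarrow> 'r) \<Rightarrow> 'a word set \<Rightarrow> 'r fps \<times> 'r fps" where
  "affine_rep la mu = lift (affine_eval la mu)"

definition compatible :: "('a \<Rightarrow> 'r::comm_ring_1) \<Rightarrow> ('a \<Rightarrow> 'r) \<Rightarrow> bool" where
  "compatible la mu \<longleftrightarrow> (\<forall>v w. v \<rightarrow> w \<longrightarrow> la v * mu w = la w * mu v)"

context
  fixes la mu :: "'a \<Rightarrow> 'r::comm_ring_1"
  assumes compat: "compatible la mu"
begin

lemma affine_rep_cls:
  assumes "u \<in> words V"
  shows "affine_rep la mu (cls u) = affine_eval la mu u"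
  unfolding affine_rep_def
proof (rule lift_cls[OF assms])
  show "affine_eval la mu u = affine_eval la mu u'" if "pres_eq V R u u'" for u u'
    using that
  proof (induction rule: pres_eq.induct)
    case (cancel u x b v)
    then show ?case by (simp only: affine_eval_append affine_eval_cancel affine_mult_one)
  next
    case (relator u r v)
    then have "affine_eval la mu r = (1, 0)"
      using compat by (auto simp: compatible_def intro!: affine_eval_commutator)
    then show ?case by (simp add: affine_eval_append)
  qed auto
qed

lemma affine_rep_mult:
  assumes "g \<in> carrier G" "h \<in> carrier G"
  shows "affine_rep la mu (g \<otimes>\<^bsub>G\<^esub> h) = affine_mult (affine_rep la mu g) (affine_rep la mu h)"
  using assms by (auto simp: carrier_raag affine_rep_cls affine_eval_append simp flip: cls_append)

lemma affine_rep_gen: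
  "v \<in> V \<Longrightarrow> affine_rep la mu (gen v) = (1 + fps_const (la v) * fps_X, fps_const (mu v))"
  by (simp add: affine_rep_cls affine_eval_Cons affine_letter_def)

end

lemma affine_rep_coeff_degree_le:
  assumes "compatible la mu" "g \<in> carrier G"
    and "\<And>v. degree (la v) \<le> 1" and "\<And>v. degree (mu v) = 0"
  shows "coeff_degree_le (fst (affine_rep la mu g))" "coeff_degree_le (snd (affine_rep la mu g))"
  using assms coeff_degree_le_affine_eval[of la mu, OF assms(3,4)]
  by (auto simp: carrier_raag affine_rep_cls)

lemma additive_eqI:
  fixes f h :: "'a word set \<Rightarrow> 'c::ab_group_add"
  assumes f: "\<And>a b. a \<in> carrier G \<Longrightarrow> b \<in> carrier G \<Longrightarrow> f (a \<otimes>\<^bsub>G\<^esub> b) = f a + f b"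
    and h: "\<And>a b. a \<in> carrier G \<Longrightarrow> b \<in> carrier G \<Longrightarrow> h (a \<otimes>\<^bsub>G\<^esub> b) = h a + h b"
    and gen: "\<And>v. v \<in> V \<Longrightarrow> f (gen v) = h (gen v)"
    and g: "g \<in> carrier G"
  shows "f g = h g"
proof -
  have one: "f \<one>\<^bsub>G\<^esub> = 0" "h \<one>\<^bsub>G\<^esub> = 0" using f[of "\<one>\<^bsub>G\<^esub>" "\<one>\<^bsub>G\<^esub>"] h[of "\<one>\<^bsub>G\<^esub>" "\<one>\<^bsub>G\<^esub>"] by auto
  have inv: "f (inv\<^bsub>G\<^esub> a) = - f a" "h (inv\<^bsub>G\<^esub> a) = - h a" if "a \<in> carrier G" for a
    using f[of a "inv\<^bsub>G\<^esub> a"] h[of a "inv\<^bsub>G\<^esub> a"] that one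
    by (simp_all add: add_eq_0_iff minus_equation_iff[of "f a"] eq_commute[of "- f a"] eq_commute[of "- h a"] del: minus_add_distrib)
  have "g \<in> generate G (gen ` V)" using g generate_gen by simp
  then show ?thesis
  proof (induction rule: generate.induct)
    case (eng a b)
    then show ?case using generate_gen by (simp add: f h)
  qed (auto simp: one inv gen)
qed

text \<open>
  A homomorphism to \<open>\<int>/2\<close> is determined by its values on the generators and so depends on the
  parity vector alone. This is how an automorphism acts on parity vectors.
\<close>
lemma additive_bit:
  fixes f :: "'a word set \<Rightarrow> bit"
  assumes f: "\<And>a b. a \<in> carrier G \<Longrightarrow> b \<in> carrier G \<Longrightarrow> f (a \<otimes>\<^bsub>G\<^esub> b) = f a + f b"
    and g: "g \<in> carrier G"
  shows "f g = (\<Sum>v\<in>V. parity v g * f (gen v))"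
  using g
proof (rule additive_eqI[OF f, rotated -1])
  fix v assume "v \<in> V"
  have "(\<Sum>w\<in>V. parity w (gen v) * f (gen w)) = (\<Sum>w\<in>V. if w = v then f (gen w) else 0)"
    using \<open>v \<in> V\<close> by (intro sum.cong) (auto simp: parity_gen)
  then show "f (gen v) = (\<Sum>w\<in>V. parity w (gen v) * f (gen w))"
    using \<open>v \<in> V\<close> by simp
qed (simp_all add: parity_mult algebra_simps sum.distrib)

context
  fixes la mu :: "'a \<Rightarrow> 'r::comm_ring_1"
  assumes compat: "compatible la mu"
begin

lemma affine_rep_nth_0 [simp]:
  assumes "g \<in> carrier G"
  shows "fst (affine_rep la mu g) $ 0 = 1"
  using assms by (auto simp: carrier_raag affine_rep_cls[OF compat] fst_affine_eval_nth_0)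

lemma affine_rep_nth_mult:
  assumes g: "g \<in> carrier G" and h: "h \<in> carrier G"
  shows "fst (affine_rep la mu (g \<otimes>\<^bsub>G\<^esub> h)) $ 1 = fst (affine_rep la mu g) $ 1 + fst (affine_rep la mu h) $ 1"
    and "snd (affine_rep la mu (g \<otimes>\<^bsub>G\<^esub> h)) $ 0 = snd (affine_rep la mu g) $ 0 + snd (affine_rep la mu h) $ 0"
  using assms by (simp_all add: affine_rep_mult[OF compat] affine_mult_def fps_mult_nth_1)

lemma affine_rep_nth_gen:
  assumes "v \<in> V"
  shows "fst (affine_rep la mu (gen v)) $ 1 = la v" "snd (affine_rep la mu (gen v)) $ 0 = mu v"
  using assms by (simp_all add: affine_rep_gen[OF compat])

text \<open>
  The multipliers lie in a commutative ring, so a commutator acts as a translation. Modulo \<open>T\<^sup>2\<close> the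
  translation is the alternating form \<open>(\<lambda>(a) \<mu>(b) - \<lambda>(b) \<mu>(a)) T\<close>; if \<open>b\<close> is a translation itself, it is
  multiplied by \<open>fst A - 1\<close>, which is divisible by \<open>T\<close>.
\<close>
lemma affine_rep_commutator:
  fixes a b
  defines "A \<equiv> affine_rep la mu a" and "B \<equiv> affine_rep la mu b"
  assumes a: "a \<in> carrier G" and b: "b \<in> carrier G"
  shows "affine_rep la mu (G.commutator a b) = (1, (fst A - 1) * snd B - (fst B - 1) * snd A)"
proof -
  have [simp]: "G.commutator a b \<in> carrier G" using a b by (simp add: G.commutator_def)
  let ?c = "affine_rep la mu (G.commutator a b)"
  have "G.commutator a b \<otimes>\<^bsub>G\<^esub> (b \<otimes>\<^bsub>G\<^esub> a) = a \<otimes>\<^bsub>G\<^esub> b"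
    using a b by (simp add: G.commutator_def G.m_assoc) (simp flip: G.m_assoc)
  then have eq: "affine_mult ?c (affine_mult B A) = affine_mult A B"
    using a b by (simp add: A_def B_def flip: affine_rep_mult[OF compat])
  have one: "affine_rep la mu \<one>\<^bsub>G\<^esub> = (1, 0)"
    by (simp add: one_raag affine_rep_cls[OF compat])
  obtain A' where A': "fst A * A' = 1"
    using affine_rep_mult[OF compat, of a "inv\<^bsub>G\<^esub> a"] a one
    by (auto simp: A_def affine_mult_def prod_eq_iff)
  obtain B' where B': "fst B * B' = 1"
    using affine_rep_mult[OF compat, of b "inv\<^bsub>G\<^esub> b"] b one
    by (auto simp: B_def affine_mult_def prod_eq_iff)
  have "fst ?c * (fst B * fst A) = fst A * fst B"
    using eq by (simp add: affine_mult_def)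
  then have "fst ?c * (fst B * fst A) * (A' * B') = fst A * fst B * (A' * B')" by simp
  also have "fst A * fst B * (A' * B') = (fst A * A') * (fst B * B')" by (simp add: mult_ac)
  finally have "fst ?c * ((fst A * A') * (fst B * B')) = (fst A * A') * (fst B * B')"
    by (simp add: mult_ac)
  then have c1: "fst ?c = 1" by (simp add: A' B')
  then have "snd ?c + (snd B + fst B * snd A) = snd A + fst A * snd B"
    using eq by (simp add: affine_mult_def)
  then have "snd ?c = (fst A - 1) * snd B - (fst B - 1) * snd A"
    by (simp add: algebra_simps)
  then show ?thesis using c1 by (simp add: prod_eq_iff)
qed

end

section \<open>Centralizers modulo 2\<close>

text \<open>
  The affine representation for the indicator functions of \<open>v\<close> and \<open>w\<close> exists because \<open>v\<close> and \<open>w\<close> are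
  not adjacent. Modulo \<open>T\<^sup>2\<close> it is a Heisenberg group, in which elements commute only if this
  determinant vanishes.
\<close>

lemma parity_commute:
  assumes g: "g \<in> carrier G" and h: "h \<in> carrier G"
    and comm: "g \<otimes>\<^bsub>G\<^esub> h = h \<otimes>\<^bsub>G\<^esub> g"
    and vw: "v \<in> V" "w \<in> V" "\<not> v \<rightarrow> w"
  shows "parity v g * parity w h = parity w g * parity v h"
proof -
  define la mu :: "'a \<Rightarrow> bit" where "la u = of_bool (u = v)" and "mu u = of_bool (u = w)" for u
  have "\<not> w \<rightarrow> v" using vw(3) arcs_ends_symmetric[OF sym_arcs] by blast
  then have compat: "compatible la mu"
    using vw(3) by (auto simp: compatible_def la_def mu_def)
  let ?r = "affine_rep la mu"
  have v: "fst (?r x) $ 1 = parity v x" if "x \<in> carrier G" for x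
    using that by (rule additive_eqI[rotated -1])
      (auto simp: affine_rep_nth_mult[OF compat, simplified] affine_rep_nth_gen[OF compat, simplified] parity_mult parity_gen, simp_all add: la_def)
  have w: "snd (?r x) $ 0 = parity w x" if "x \<in> carrier G" for x
    using that by (rule additive_eqI[rotated -1])
      (auto simp: affine_rep_nth_mult[OF compat] affine_rep_nth_gen[OF compat] parity_mult parity_gen, simp_all add: mu_def)
  have "affine_mult (?r g) (?r h) = affine_mult (?r h) (?r g)"
    using g h comm by (simp flip: affine_rep_mult[OF compat])
  then have "snd (affine_mult (?r g) (?r h)) $ 1 = snd (affine_mult (?r h) (?r g)) $ 1" by simp
  then have "parity v g * parity w h = parity v h * parity w g"
    using g h v[of g] v[of h] w by (simp add: affine_mult_def fps_mult_nth_1 affine_rep_nth_0[OF compat] algebra_simps)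
  then show ?thesis by (simp add: mult.commute)
qed

definition nbhd :: "'a \<Rightarrow> 'a set" where
  "nbhd v = insert v {w. v \<rightarrow> w}"

lemma adj_sym: "v \<rightarrow> w \<Longrightarrow> w \<rightarrow> v"
  by (rule arcs_ends_symmetric[OF sym_arcs])

lemma adj_irrefl: "v \<rightarrow> w \<Longrightarrow> w \<noteq> v"
  using no_loops by (fastforce simp: arcs_ends_conv)

lemma card_nbhd: "card (nbhd v) = Suc (out_degree \<Gamma> v)"
proof -
  have "{w. v \<rightarrow> w} = head \<Gamma> ` out_arcs \<Gamma> v"
    by (auto simp: out_arcs_def arcs_ends_conv)
  moreover have "inj_on (head \<Gamma>) (out_arcs \<Gamma> v)"
    by (auto simp: inj_on_def out_arcs_def arc_to_ends_def intro: no_multi_arcs)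
  ultimately have "card {w. v \<rightarrow> w} = out_degree \<Gamma> v"
    by (simp add: card_image out_degree_def)
  moreover have "v \<notin> {w. v \<rightarrow> w}" using adj_irrefl by blast
  moreover have "finite {w. v \<rightarrow> w}" by (rule finite_subset[of _ V]) auto
  ultimately show ?thesis by (simp add: nbhd_def)
qed

lemma nbhd_subset: "v \<in> V \<Longrightarrow> nbhd v \<subseteq> V"
  by (auto simp: nbhd_def)

text \<open>
  The centralizer of a generator is large: its parity vectors include all those supported on the closed
  neighbourhood, realized by products of commuting generators.
\<close>
lemma centralizer_of_gen:
  assumes v: "v \<in> V" and S: "S \<subseteq> nbhd v"
  shows "\<exists>g\<in>carrier G. gen v \<otimes>\<^bsub>G\<^esub> g = g \<otimes>\<^bsub>G\<^esub> gen v \<and> (\<forall>w\<in>V. parity w g = of_bool (w \<in> S))"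
proof -
  have "finite S" using finite_subset[OF order_trans[OF S nbhd_subset[OF v]]] by simp
  then show ?thesis using S
  proof (induction S)
    case empty
    have "parity w \<one>\<^bsub>G\<^esub> = 0" for w by (simp add: one_raag parity_cls)
    then show ?case using v by (intro bexI[of _ "\<one>\<^bsub>G\<^esub>"]) auto
  next
    case (insert u S)
    then obtain g where g: "g \<in> carrier G" "gen v \<otimes>\<^bsub>G\<^esub> g = g \<otimes>\<^bsub>G\<^esub> gen v"
      "\<And>w. w \<in> V \<Longrightarrow> parity w g = of_bool (w \<in> S)" by auto
    have u: "u \<in> V" using insert.prems nbhd_subset[OF v] by auto
    have c: "gen v \<otimes>\<^bsub>G\<^esub> gen u = gen u \<otimes>\<^bsub>G\<^esub> gen v"
      using insert.prems gen_commute by (auto simp: nbhd_def)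
    have "gen v \<otimes>\<^bsub>G\<^esub> (gen u \<otimes>\<^bsub>G\<^esub> g) = (gen v \<otimes>\<^bsub>G\<^esub> gen u) \<otimes>\<^bsub>G\<^esub> g"
      by (rule G.m_assoc[symmetric]) (simp_all add: u v g(1))
    also have "\<dots> = gen u \<otimes>\<^bsub>G\<^esub> (gen v \<otimes>\<^bsub>G\<^esub> g)"
      unfolding c by (rule G.m_assoc) (simp_all add: u v g(1))
    also have "\<dots> = (gen u \<otimes>\<^bsub>G\<^esub> g) \<otimes>\<^bsub>G\<^esub> gen v"
      unfolding g(2) by (rule G.m_assoc[symmetric]) (simp_all add: u v g(1))
    finally have "gen v \<otimes>\<^bsub>G\<^esub> (gen u \<otimes>\<^bsub>G\<^esub> g) = (gen u \<otimes>\<^bsub>G\<^esub> g) \<otimes>\<^bsub>G\<^esub> gen v" .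
    moreover have "parity w (gen u \<otimes>\<^bsub>G\<^esub> g) = of_bool (w \<in> insert u S)" if "w \<in> V" for w
      using parity_mult[OF gen_carrier[OF u] g(1)] g(3)[OF that] parity_gen[OF u] insert.hyps(2) by auto
    ultimately show ?case
      using g(1) u by (intro bexI[of _ "gen u \<otimes>\<^bsub>G\<^esub> g"]) auto
  qed
qed

text \<open>
  The parity vectors of the elements \<open>f(g)\<close>, for \<open>g\<close> in the centralizer of \<open>v\<close>, number at least
  \<open>2 ^ card (nbhd v)\<close>, since the inverse automorphism recovers the vector of \<open>g\<close>. As these elements commute with
  \<open>f(v)\<close>, which involves \<open>u\<close>, their vectors are determined by their restrictions to \<open>nbhd u\<close>.
\<close>
lemma auto_out_degree_le:
  assumes f: "f \<in> auto G" and v: "v \<in> V" and u: "u \<in> V" and supp: "parity u (f (gen v)) = 1"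
  shows "out_degree \<Gamma> v \<le> out_degree \<Gamma> u"
proof -
  obtain h where h: "h \<in> auto G" "\<forall>a\<in>carrier G. h (f a) = a \<and> f (h a) = a"
    using G.auto_inverse[OF f] by blast
  define g where "g S = (SOME g. g \<in> carrier G \<and> gen v \<otimes>\<^bsub>G\<^esub> g = g \<otimes>\<^bsub>G\<^esub> gen v \<and>
    (\<forall>w\<in>V. parity w g = of_bool (w \<in> S)))" for S
  have gS: "g S \<in> carrier G \<and> gen v \<otimes>\<^bsub>G\<^esub> g S = g S \<otimes>\<^bsub>G\<^esub> gen v \<and>
    (\<forall>w\<in>V. parity w (g S) = of_bool (w \<in> S))" if "S \<subseteq> nbhd v" for S
    unfolding g_def by (rule someI_ex) (use centralizer_of_gen[OF v that] in blast)
  have g: "g S \<in> carrier G" and comm: "gen v \<otimes>\<^bsub>G\<^esub> g S = g S \<otimes>\<^bsub>G\<^esub> gen v"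
    and par: "\<And>w. w \<in> V \<Longrightarrow> parity w (g S) = of_bool (w \<in> S)" if "S \<subseteq> nbhd v" for S
    using gS[OF that] by blast+
  define F where "F S = {w \<in> nbhd u. parity w (f (g S)) = 1}" for S
  have "inj_on F (Pow (nbhd v))"
  proof (rule inj_onI)
    fix S S' assume "S \<in> Pow (nbhd v)" "S' \<in> Pow (nbhd v)" and eq: "F S = F S'"
    then have S: "S \<subseteq> nbhd v" "S' \<subseteq> nbhd v" by auto
    have near: "parity w (f (g S)) = parity w (f (g S'))" if "w \<in> nbhd u" for w
    proof -
      have "w \<in> F S \<longleftrightarrow> w \<in> F S'" using eq by simp
      then have "parity w (f (g S)) = 1 \<longleftrightarrow> parity w (f (g S')) = 1"
        using that by (simp add: F_def)
      then show ?thesis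
        using bit_cases[of "parity w (f (g S))"] bit_cases[of "parity w (f (g S'))"] by auto
    qed
    have far: "parity w (f (g T)) = parity w (f (gen v)) * parity u (f (g T))"
      if "w \<in> V" "w \<notin> nbhd u" "T \<subseteq> nbhd v" for w T
    proof -
      have "f (gen v) \<otimes>\<^bsub>G\<^esub> f (g T) = f (g T) \<otimes>\<^bsub>G\<^esub> f (gen v)"
        using arg_cong[OF comm[OF that(3)], of f] g[OF that(3)] v by (simp add: G.auto_hom_simps[OF f])
      then have "parity u (f (gen v)) * parity w (f (g T)) = parity w (f (gen v)) * parity u (f (g T))"
        using that g[OF that(3)] v u f by (intro parity_commute) (auto simp: G.auto_hom_simps nbhd_def)
      then show ?thesis by (simp add: supp)
    qed
    have all: "parity w (f (g S)) = parity w (f (g S'))" if w: "w \<in> V" for w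
    proof (cases "w \<in> nbhd u")
      case False
      have "u \<in> nbhd u" by (simp add: nbhd_def)
      then show ?thesis using far[OF w False S(1)] far[OF w False S(2)] near[of u] by simp
    qed (rule near)
    have "parity t (g S) = parity t (g S')" for t
    proof -
      have "parity t (h x) = (\<Sum>w\<in>V. parity w x * parity t (h (gen w)))" if "x \<in> carrier G" for x
        using that by (rule additive_bit[rotated]) (simp add: G.auto_hom_simps[OF h(1)] parity_mult)
      from this[of "f (g S)"] this[of "f (g S')"]
      have "parity t (h (f (g S))) = parity t (h (f (g S')))"
        using all S g by (simp add: G.auto_hom_simps[OF f] cong: sum.cong)
      then show ?thesis using S g h(2) by simp
    qed
    then have "of_bool (t \<in> S) = (of_bool (t \<in> S') :: bit)" if "t \<in> V" for t
      using par[OF S(1) that] par[OF S(2) that] \<open>\<And>t. parity t (g S) = parity t (g S')\<close> by simp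
    then have "t \<in> S \<longleftrightarrow> t \<in> S'" if "t \<in> V" for t using that by fastforce
    then show "S = S'" using S nbhd_subset[OF v] by blast
  qed
  moreover have "F ` Pow (nbhd v) \<subseteq> Pow (nbhd u)" by (auto simp: F_def)
  moreover have fin: "finite (nbhd x)" for x using card_nbhd[of x] by (metis card.infinite nat.distinct(1))
  ultimately have "card (Pow (nbhd v)) \<le> card (Pow (nbhd u))"
    by (meson card_inj_on_le finite_Pow_iff)
  then show ?thesis using fin by (simp add: card_Pow card_nbhd)
qed

end

section \<open>Characters permuted by the automorphisms\<close>

locale raag_one_small = raag_graph +
  fixes v0 :: 'a and d :: nat
  assumes v0 [simp]: "v0 \<in> verts \<Gamma>"
    and small: "out_degree \<Gamma> v0 < d"
    and large: "v \<in> verts \<Gamma> \<Longrightarrow> v \<noteq> v0 \<Longrightarrow> out_degree \<Gamma> v = d"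
    and not_single: "verts \<Gamma> \<noteq> {v0}"
begin

definition far_verts :: "'a set" where
  "far_verts = V - nbhd v0"

text \<open>
  Otherwise \<open>v0\<close> would be adjacent to all other vertices and have the largest degree possible.
\<close>
lemma far_verts_nonempty: "far_verts \<noteq> {}"
proof
  assume "far_verts = {}"
  then have "nbhd v0 = V" using nbhd_subset[OF v0] by (auto simp: far_verts_def)
  then have "card V \<le> d" using small card_nbhd[of v0] by simp
  moreover obtain v where v: "v \<in> V" "v \<noteq> v0" using not_single v0 by blast
  moreover have "card (nbhd v) \<le> card V" using nbhd_subset[OF v(1)] by (simp add: card_mono)
  ultimately show False using card_nbhd[of v] large[OF v] by simp
qed

text \<open>
  The generator \<open>v0\<close> cannot occur in the image of a vertex of larger degree. It must then occur in its own
  image, because \<open>f\<close> is surjective.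
\<close>
lemma parity_v0_auto:
  assumes f: "f \<in> auto G" and g: "g \<in> carrier G"
  shows "parity v0 (f g) = parity v0 g"
proof -
  have add: "parity v0 (f (a \<otimes>\<^bsub>G\<^esub> b)) = parity v0 (f a) + parity v0 (f b)"
    if "a \<in> carrier G" "b \<in> carrier G" for a b
    using that by (simp add: G.auto_hom_simps[OF f] parity_mult)
  have others: "parity v0 (f (gen v)) = 0" if "v \<in> V" "v \<noteq> v0" for v
    using auto_out_degree_le[OF f that(1) v0] large[OF that] small bit_cases[of "parity v0 (f (gen v))"]
    by linarith
  have "parity v0 (f (gen v0)) = 1"
  proof (rule ccontr)
    assume "parity v0 (f (gen v0)) \<noteq> 1"
    then have zero: "parity v0 (f (gen v)) = 0" if "v \<in> V" for v
      using others that bit_cases by (cases "v = v0") auto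
    obtain h where h: "h \<in> auto G" "\<forall>a\<in>carrier G. h (f a) = a \<and> f (h a) = a"
      using G.auto_inverse[OF f] by blast
    have "parity v0 (f x) = 0" if "x \<in> carrier G" for x
      using additive_bit[of "\<lambda>x. parity v0 (f x)", OF add that] zero by simp
    from this[of "h (gen v0)"] show False
      using h by (simp add: G.auto_hom_simps[OF h(1)] parity_gen)
  qed
  then show ?thesis
    using others
    by (intro additive_eqI[where f="\<lambda>x. parity v0 (f x)" and h="parity v0", OF add parity_mult _ g])
      (auto simp: parity_gen)
qed

text \<open>
  The images of \<open>l\<close> and \<open>v0\<close> commute, the latter involves \<open>v0\<close> and the former does not; the vanishing
  determinant for the non-adjacent vertices \<open>v0\<close> and \<open>w\<close> then excludes \<open>w\<close>.
\<close>
lemma parity_far_auto: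
  assumes f: "f \<in> auto G" and l: "v0 \<rightarrow> l" and w: "w \<in> far_verts"
  shows "parity w (f (gen l)) = 0"
proof -
  have lV: "l \<in> V" using l by auto
  have "l \<noteq> v0" using adj_irrefl[OF l] .
  have "f (gen v0) \<otimes>\<^bsub>G\<^esub> f (gen l) = f (gen l) \<otimes>\<^bsub>G\<^esub> f (gen v0)"
    using arg_cong[OF gen_commute[OF l], of f] lV by (simp add: G.auto_hom_simps[OF f])
  then have "parity v0 (f (gen v0)) * parity w (f (gen l)) = parity w (f (gen v0)) * parity v0 (f (gen l))"
    using w lV by (intro parity_commute) (auto simp: far_verts_def nbhd_def G.auto_hom_simps[OF f])
  then show ?thesis
    using \<open>l \<noteq> v0\<close> lV by (simp add: parity_v0_auto[OF f] parity_gen)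
qed

definition character :: "('a \<Rightarrow> bit) \<Rightarrow> 'a word set \<Rightarrow> bit" where
  "character xi g = (\<Sum>v\<in>V. parity v g * xi v)"

lemma character_mult:
  "a \<in> carrier G \<Longrightarrow> b \<in> carrier G \<Longrightarrow> character xi (a \<otimes>\<^bsub>G\<^esub> b) = character xi a + character xi b"
  by (simp add: character_def parity_mult algebra_simps sum.distrib)

lemma character_gen: "v \<in> V \<Longrightarrow> character xi (gen v) = xi v"
proof -
  assume v: "v \<in> V"
  have "character xi (gen v) = (\<Sum>w\<in>V. if w = v then xi w else 0)"
    unfolding character_def using v by (intro sum.cong) (auto simp: parity_gen)
  then show ?thesis using v by simp
qed

definition pullback :: "('a word set \<Rightarrow> 'a word set) \<Rightarrow> ('a \<Rightarrow> bit) \<Rightarrow> 'a \<Rightarrow> bit" where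
  "pullback f xi v = (if v \<in> V then character xi (f (gen v)) else 0)"

lemma character_pullback:
  assumes "f \<in> auto G" "g \<in> carrier G"
  shows "character (pullback f xi) g = character xi (f g)"
  by (rule additive_eqI[where f="character (pullback f xi)" and h="\<lambda>x. character xi (f x)",
        OF character_mult _ _ assms(2)])
    (use assms(1) in \<open>simp_all add: character_gen pullback_def G.auto_hom_simps character_mult\<close>)

definition far_chars :: "('a \<Rightarrow> bit) set" where
  "far_chars = {xi. (\<forall>v. v \<notin> V \<or> v0 \<rightarrow> v \<longrightarrow> xi v = 0) \<and> (\<exists>w\<in>far_verts. xi w = 1)}"

lemma finite_far_chars: "finite far_chars"
proof (rule finite_subset)
  show "far_chars \<subseteq> {xi. \<forall>v. (v \<in> V \<longrightarrow> xi v \<in> {0, 1}) \<and> (v \<notin> V \<longrightarrow> xi v = 0)}"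
    using bit_cases by (auto simp: far_chars_def)
qed (rule finite_set_of_finite_funs; simp)

lemma far_chars_nonempty: "far_chars \<noteq> {}"
proof -
  obtain w where "w \<in> far_verts" using far_verts_nonempty by auto
  then have "(\<lambda>v. of_bool (v = w)) \<in> far_chars" by (auto simp: far_chars_def far_verts_def nbhd_def)
  then show ?thesis by auto
qed

text \<open>
  The pulled-back function vanishes on the neighbours of \<open>v0\<close> because their images involve only such neighbours.
  If it vanished on the far vertices too, its character would be a multiple of the parity of \<open>v0\<close>,
  hence zero at the preimage of a far vertex at which \<open>xi\<close> is 1.
\<close>
lemma pullback_far_chars:
  assumes f: "f \<in> auto G" and xi: "xi \<in> far_chars"
  shows "pullback f xi \<in> far_chars"
proof -
  have near: "pullback f xi l = 0" if l: "v0 \<rightarrow> l" for l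
  proof -
    have lV: "l \<in> V" using l by auto
    have "l \<noteq> v0" using adj_irrefl[OF l] .
    have "parity v (f (gen l)) * xi v = 0" if v: "v \<in> V" for v
    proof (cases "v \<in> far_verts")
      case True
      then show ?thesis using parity_far_auto[OF f l] by simp
    next
      case False
      then show ?thesis
        using v xi lV \<open>l \<noteq> v0\<close> parity_v0_auto[OF f, of "gen l"]
        by (auto simp: far_chars_def far_verts_def nbhd_def parity_gen)
    qed
    then have "(\<Sum>v\<in>V. parity v (f (gen l)) * xi v) = 0" by (intro sum.neutral ballI)
    then show ?thesis using lV by (simp only: pullback_def character_def if_True)
  qed
  have "\<exists>w\<in>far_verts. pullback f xi w = 1"
  proof (rule ccontr)
    assume "\<not> ?thesis"
    then have zero: "pullback f xi v = 0" if "v \<in> V" "v \<noteq> v0" for v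
      using that near bit_cases by (cases "v0 \<rightarrow> v") (auto simp: far_verts_def nbhd_def)
    obtain w where w: "w \<in> far_verts" "xi w = 1" using xi by (auto simp: far_chars_def)
    then have wV: "w \<in> V" "w \<noteq> v0" by (auto simp: far_verts_def nbhd_def)
    obtain h where h: "h \<in> auto G" "\<forall>a\<in>carrier G. h (f a) = a \<and> f (h a) = a"
      using G.auto_inverse[OF f] by blast
    let ?g = "h (gen w)"
    have "character (pullback f xi) ?g = 1"
      using character_pullback[OF f, of ?g xi] h wV w by (simp add: G.auto_hom_simps[OF h(1)] character_gen)
    moreover have *: "parity v ?g * pullback f xi v = 0" if "v \<in> V" for v
      using zero[OF that] parity_v0_auto[OF h(1), of "gen w"] wV by (cases "v = v0") (auto simp: parity_gen)
    have "character (pullback f xi) ?g = 0"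
      unfolding character_def using * by (intro sum.neutral ballI)
    ultimately show False by simp
  qed
  moreover have "pullback f xi v = 0" if "v \<notin> V" for v using that by (simp add: pullback_def)
  ultimately show ?thesis using near by (auto simp: far_chars_def)
qed

section \<open>Leading coefficients of iterated commutators\<close>

text \<open>
  The value \<open>xi v + s\<close> at \<open>v = v0\<close> and \<open>xi v\<close> elsewhere. The indeterminate \<open>s\<close>
  is what makes room for infinitely many different leading coefficients.
\<close>

definition slope :: "('a \<Rightarrow> bit) \<Rightarrow> 'a \<Rightarrow> bit poly" where
  "slope xi v = [:xi v, of_bool (v = v0):]"

abbreviation rep :: "('a \<Rightarrow> bit) \<Rightarrow> 'a word set \<Rightarrow> bit poly fps \<times> bit poly fps" where
  "rep xi \<equiv> affine_rep (slope xi) (\<lambda>v. of_bool (v = v0))"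

abbreviation "chi xi g \<equiv> fst (rep xi g)"
abbreviation "del xi g \<equiv> snd (rep xi g)"

text \<open>
  A relation that involves \<open>v0\<close> pairs it with a neighbour, whose slope is zero; the other
  relations concern generators without translation part.
\<close>
lemma compatible_slope:
  assumes "xi \<in> far_chars"
  shows "compatible (slope xi) (\<lambda>v. of_bool (v = v0))"
  using assms adj_irrefl adj_sym by (fastforce simp: compatible_def slope_def far_chars_def)

lemma chi_nth_1:
  assumes xi: "xi \<in> far_chars" and g: "g \<in> carrier G"
  shows "chi xi g $ 1 = [:character xi g, parity v0 g:]"
  by (rule additive_eqI[where f="\<lambda>g. chi xi g $ 1" and h="\<lambda>g. [:character xi g, parity v0 g:]",
        OF affine_rep_nth_mult(1)[OF compatible_slope[OF xi]] _ _ g])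
    (simp_all add: affine_rep_nth_gen[OF compatible_slope[OF xi], simplified] slope_def
      character_mult character_gen parity_mult parity_gen)

lemma del_nth_0:
  assumes xi: "xi \<in> far_chars" and g: "g \<in> carrier G"
  shows "del xi g $ 0 = [:parity v0 g:]"
  by (rule additive_eqI[where f="\<lambda>g. del xi g $ 0" and h="\<lambda>g. [:parity v0 g:]",
        OF affine_rep_nth_mult(2)[OF compatible_slope[OF xi]] _ _ g])
    (simp_all add: affine_rep_nth_gen[OF compatible_slope[OF xi]] parity_mult parity_gen one_pCons)

text \<open>
  Under all automorphisms, \<open>g\<close> stays a translation by a series of order at least \<open>n\<close>, and an automorphism
  acts on the coefficient at \<open>T\<^sup>n\<close> only through its action on \<open>far_chars\<close>. For \<open>n \<ge> 1\<close> the iterated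
  commutators of \<open>n + 1\<close> elements are of this kind, but the condition is easier to handle than membership in the
  lower central series.
\<close>
definition deep :: "nat \<Rightarrow> 'a word set \<Rightarrow> bool" where
  "deep n g \<longleftrightarrow> g \<in> carrier G \<and>
     (\<forall>f\<in>auto G. \<forall>xi\<in>far_chars. chi xi (f g) = 1 \<and> (\<forall>i<n. del xi (f g) $ i = 0) \<and>
        del xi (f g) $ n = del (pullback f xi) g $ n)"

lemma deep_carrier: "deep n g \<Longrightarrow> g \<in> carrier G"
  by (simp add: deep_def)

lemma commutator_carrier [simp]:
  "a \<in> carrier G \<Longrightarrow> b \<in> carrier G \<Longrightarrow> G.commutator a b \<in> carrier G"
  by (simp add: G.commutator_def)

lemma id_auto: "(\<lambda>g\<in>carrier G. g) \<in> auto G"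
  by (rule G.id_in_auto)

lemma deep_self:
  assumes "deep n g" "xi \<in> far_chars"
  shows "chi xi g = 1" and "i < n \<Longrightarrow> del xi g $ i = 0"
  using assms id_auto deep_carrier[OF assms(1)] unfolding deep_def by fastforce+

lemma del_commutator_low:
  assumes xi: "xi \<in> far_chars" and a: "a \<in> carrier G" and b: "b \<in> carrier G"
  shows "del xi (G.commutator a b) $ 0 = 0"
    and "del xi (G.commutator a b) $ 1 = [:character xi a * parity v0 b - character xi b * parity v0 a:]"
  using a b chi_nth_1[OF xi a] chi_nth_1[OF xi b]
  by (simp_all add: affine_rep_commutator[OF compatible_slope[OF xi]] fps_mult_nth_1
      affine_rep_nth_0[OF compatible_slope[OF xi]] del_nth_0[OF xi])

text \<open>
  The coefficient at \<open>T\<close> depends only on the values of the character and of the parity of \<open>v0\<close> at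
  \<open>a\<close> and \<open>b\<close>. An automorphism pulls back the former and preserves the latter.
\<close>
lemma deep_commutator_1:
  assumes a: "a \<in> carrier G" and b: "b \<in> carrier G"
  shows "deep 1 (G.commutator a b)"
proof -
  have "chi xi (f (G.commutator a b)) = 1 \<and> del xi (f (G.commutator a b)) $ 0 = 0 \<and>
      del xi (f (G.commutator a b)) $ 1 = del (pullback f xi) (G.commutator a b) $ 1"
    if f: "f \<in> auto G" and xi: "xi \<in> far_chars" for f xi
  proof -
    have fc: "f a \<in> carrier G" "f b \<in> carrier G" using a b by (simp_all add: G.auto_hom_simps[OF f])
    have "del (pullback f xi) (G.commutator a b) $ 1 =
        [:character (pullback f xi) a * parity v0 b - character (pullback f xi) b * parity v0 a:]"
      by (rule del_commutator_low(2)[OF pullback_far_chars[OF f xi] a b])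
    also have "\<dots> = [:character xi (f a) * parity v0 (f b) - character xi (f b) * parity v0 (f a):]"
      by (simp only: character_pullback[OF f] parity_v0_auto[OF f] a b)
    also have "\<dots> = del xi (G.commutator (f a) (f b)) $ 1"
      by (rule del_commutator_low(2)[OF xi fc, symmetric])
    finally show ?thesis
      using del_commutator_low(1)[OF xi fc] fc
      by (simp only: G.auto_commutator[OF f a b]) (simp add: affine_rep_commutator[OF compatible_slope[OF xi]])
  qed
  then show ?thesis using a b by (simp add: deep_def)
qed

lemma del_commutator_deep:
  assumes xi: "xi \<in> far_chars" and a: "a \<in> carrier G" and z: "z \<in> carrier G"
    and chi: "chi xi z = 1" and low: "\<And>i. i < n \<Longrightarrow> del xi z $ i = 0"
  shows "i \<le> n \<Longrightarrow> del xi (G.commutator a z) $ i = 0"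
    and "del xi (G.commutator a z) $ Suc n = [:character xi a, parity v0 a:] * del xi z $ n"
proof -
  have eq: "del xi (G.commutator a z) = (chi xi a - 1) * del xi z"
    using a z chi by (simp add: affine_rep_commutator[OF compatible_slope[OF xi]])
  have 0: "(chi xi a - 1) $ 0 = 0" using a by (simp add: affine_rep_nth_0[OF compatible_slope[OF xi]])
  show "i \<le> n \<Longrightarrow> del xi (G.commutator a z) $ i = 0"
    unfolding eq using fps_mult_nth_low(1)[where H="del xi z", OF 0 low] by blast
  have "(chi xi a - 1) $ 1 = [:character xi a, parity v0 a:]"
    using chi_nth_1[OF xi a] by simp
  then show "del xi (G.commutator a z) $ Suc n = [:character xi a, parity v0 a:] * del xi z $ n"
    unfolding eq using fps_mult_nth_low(2)[where H="del xi z", OF 0 low] by simp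
qed

text \<open>
  Forming the commutator with \<open>a\<close> multiplies the leading coefficient by the slope of \<open>a\<close>, which an
  automorphism transforms by pulling back \<open>xi\<close>.
\<close>
lemma deep_commutator_Suc:
  assumes a: "a \<in> carrier G" and z: "deep n z"
  shows "deep (Suc n) (G.commutator a z)"
proof -
  have zc: "z \<in> carrier G" using z by (rule deep_carrier)
  have "chi xi (f (G.commutator a z)) = 1 \<and> (\<forall>i<Suc n. del xi (f (G.commutator a z)) $ i = 0) \<and>
      del xi (f (G.commutator a z)) $ Suc n = del (pullback f xi) (G.commutator a z) $ Suc n"
    if f: "f \<in> auto G" and xi: "xi \<in> far_chars" for f xi
  proof -
    have p: "pullback f xi \<in> far_chars" by (rule pullback_far_chars[OF f xi])
    have fa: "f a \<in> carrier G" "f z \<in> carrier G" using a zc by (simp_all add: G.auto_hom_simps[OF f])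
    have fz: "chi xi (f z) = 1" "\<And>i. i < n \<Longrightarrow> del xi (f z) $ i = 0"
      "del xi (f z) $ n = del (pullback f xi) z $ n"
      using z f xi by (auto simp: deep_def)
    have 1: "chi xi (G.commutator (f a) (f z)) = 1"
      using fa by (simp add: affine_rep_commutator[OF compatible_slope[OF xi]])
    have 2: "del xi (G.commutator (f a) (f z)) $ i = 0" if "i < Suc n" for i
      using del_commutator_deep(1)[OF xi fa fz(1,2), of n i] that by simp
    have 3: "del xi (G.commutator (f a) (f z)) $ Suc n = del (pullback f xi) (G.commutator a z) $ Suc n"
      using del_commutator_deep(2)[OF xi fa fz(1,2), of n]
        del_commutator_deep(2)[OF p a zc deep_self[OF z p], of n]
      by (simp add: fz(3) character_pullback[OF f a] parity_v0_auto[OF f a])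
    show ?thesis using 1 2 3 by (simp add: G.auto_commutator[OF f a zc])
  qed
  then show ?thesis using a zc by (simp add: deep_def)
qed

lemma deep_one: "deep n \<one>\<^bsub>G\<^esub>"
proof -
  have rep: "rep xi \<one>\<^bsub>G\<^esub> = (1, 0)" if "xi \<in> far_chars" for xi
    by (simp add: one_raag affine_rep_cls[OF compatible_slope[OF that]])
  have fone: "f \<one>\<^bsub>G\<^esub> = \<one>\<^bsub>G\<^esub>" if "f \<in> auto G" for f
  proof -
    interpret f: group_hom G G f by unfold_locales (use that in \<open>simp add: auto_def\<close>)
    show ?thesis by simp
  qed
  have "chi xi (f \<one>\<^bsub>G\<^esub>) = 1 \<and> (\<forall>i<n. del xi (f \<one>\<^bsub>G\<^esub>) $ i = 0) \<and>
      del xi (f \<one>\<^bsub>G\<^esub>) $ n = del (pullback f xi) \<one>\<^bsub>G\<^esub> $ n"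
    if "f \<in> auto G" "xi \<in> far_chars" for f xi
    by (simp add: fone[OF that(1)] rep that(2) pullback_far_chars[OF that])
  then show ?thesis by (simp add: deep_def)
qed

lemma del_mult_deep:
  assumes "xi \<in> far_chars" "g \<in> carrier G" "h \<in> carrier G" "chi xi g = 1" "chi xi h = 1"
  shows "chi xi (g \<otimes>\<^bsub>G\<^esub> h) = 1" "del xi (g \<otimes>\<^bsub>G\<^esub> h) = del xi g + del xi h"
  using assms by (simp_all add: affine_rep_mult[OF compatible_slope] affine_mult_def)

lemma deep_mult:
  assumes g: "deep n g" and h: "deep n h"
  shows "deep n (g \<otimes>\<^bsub>G\<^esub> h)"
proof -
  have c: "g \<in> carrier G" "h \<in> carrier G" using assms by (auto dest: deep_carrier)
  have "chi xi (f (g \<otimes>\<^bsub>G\<^esub> h)) = 1 \<and> (\<forall>i<n. del xi (f (g \<otimes>\<^bsub>G\<^esub> h)) $ i = 0) \<and>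
      del xi (f (g \<otimes>\<^bsub>G\<^esub> h)) $ n = del (pullback f xi) (g \<otimes>\<^bsub>G\<^esub> h) $ n"
    if f: "f \<in> auto G" and xi: "xi \<in> far_chars" for f xi
  proof -
    have p: "pullback f xi \<in> far_chars" by (rule pullback_far_chars[OF f xi])
    have "chi xi (f x) = 1 \<and> (\<forall>i<n. del xi (f x) $ i = 0) \<and> del xi (f x) $ n = del (pullback f xi) x $ n"
      if "deep n x" for x
      using that f xi by (auto simp: deep_def)
    from this[OF g] this[OF h] show ?thesis
      using del_mult_deep[OF p c deep_self(1)[OF g p] deep_self(1)[OF h p]]
        del_mult_deep[OF xi G.auto_hom_simps(1)[OF f c(1)] G.auto_hom_simps(1)[OF f c(2)]]
      by (simp add: G.auto_hom_simps[OF f] c)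
  qed
  then show ?thesis using c by (simp add: deep_def)
qed

section \<open>Leading coefficients that do not depend on the character\<close>

definition realizable :: "nat \<Rightarrow> (('a \<Rightarrow> bit) \<Rightarrow> bit poly) \<Rightarrow> bool" where
  "realizable n F \<longleftrightarrow> (\<exists>z. deep n z \<and> (\<forall>xi\<in>far_chars. del xi z $ n = F xi))"

text \<open>
  Sums require a common \<open>n\<close>, whereas products with slopes increase \<open>n\<close>. Asking for all large \<open>n\<close> makes
  both operations available without counting degrees.
\<close>
definition eventually_realizable :: "(('a \<Rightarrow> bit) \<Rightarrow> bit poly) \<Rightarrow> bool" where
  "eventually_realizable F \<longleftrightarrow> (\<exists>m. \<forall>n\<ge>m. realizable n F)"

lemma realizable_cong: "(\<And>xi. xi \<in> far_chars \<Longrightarrow> F xi = H xi) \<Longrightarrow> realizable n F \<longleftrightarrow> realizable n H"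
  by (simp add: realizable_def)

lemma eventually_realizable_cong:
  "(\<And>xi. xi \<in> far_chars \<Longrightarrow> F xi = H xi) \<Longrightarrow> eventually_realizable F \<longleftrightarrow> eventually_realizable H"
  using realizable_cong[of F H] by (simp add: eventually_realizable_def)

lemma realizable_mult:
  assumes a: "a \<in> carrier G" and F: "realizable n F"
  shows "realizable (Suc n) (\<lambda>xi. [:character xi a, parity v0 a:] * F xi)"
proof -
  obtain z where z: "deep n z" "\<And>xi. xi \<in> far_chars \<Longrightarrow> del xi z $ n = F xi"
    using F by (auto simp: realizable_def)
  show ?thesis unfolding realizable_def
  proof (intro exI conjI ballI)
    show "deep (Suc n) (G.commutator a z)" by (rule deep_commutator_Suc[OF a z(1)])
    fix xi assume xi: "xi \<in> far_chars"
    show "del xi (G.commutator a z) $ Suc n = [:character xi a, parity v0 a:] * F xi"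
      unfolding z(2)[OF xi, symmetric]
      by (rule del_commutator_deep(2)[OF xi a deep_carrier[OF z(1)] deep_self[OF z(1) xi]])
  qed
qed

lemma eventually_realizable_zero: "eventually_realizable (\<lambda>xi. 0)"
proof -
  have "realizable n (\<lambda>xi. 0)" for n
    unfolding realizable_def using deep_one
    by (intro exI[of _ "\<one>\<^bsub>G\<^esub>"]) (simp add: one_raag affine_rep_cls[OF compatible_slope])
  then show ?thesis by (simp add: eventually_realizable_def)
qed

lemma eventually_realizable_add:
  assumes "eventually_realizable F" "eventually_realizable H"
  shows "eventually_realizable (\<lambda>xi. F xi + H xi)"
proof -
  have add: "realizable n (\<lambda>xi. F xi + H xi)" if F: "realizable n F" and H: "realizable n H" for n
  proof -
    obtain z where z: "deep n z" "\<And>xi. xi \<in> far_chars \<Longrightarrow> del xi z $ n = F xi"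
      using F by (auto simp: realizable_def)
    obtain y where y: "deep n y" "\<And>xi. xi \<in> far_chars \<Longrightarrow> del xi y $ n = H xi"
      using H by (auto simp: realizable_def)
    have "del xi (z \<otimes>\<^bsub>G\<^esub> y) $ n = F xi + H xi" if xi: "xi \<in> far_chars" for xi
      using del_mult_deep(2)[OF xi deep_carrier[OF z(1)] deep_carrier[OF y(1)]
          deep_self(1)[OF z(1) xi] deep_self(1)[OF y(1) xi]] z(2)[OF xi] y(2)[OF xi] by simp
    then show ?thesis using deep_mult[OF z(1) y(1)] by (auto simp: realizable_def)
  qed
  obtain m m' where "\<And>n. m \<le> n \<Longrightarrow> realizable n F" "\<And>n. m' \<le> n \<Longrightarrow> realizable n H"
    using assms by (auto simp: eventually_realizable_def)
  then show ?thesis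
    unfolding eventually_realizable_def by (intro exI[of _ "max m m'"]) (simp add: add)
qed

lemma eventually_realizable_mult:
  assumes a: "a \<in> carrier G" and F: "eventually_realizable F"
  shows "eventually_realizable (\<lambda>xi. [:character xi a, parity v0 a:] * F xi)"
proof -
  obtain m where m: "\<And>n. m \<le> n \<Longrightarrow> realizable n F"
    using F by (auto simp: eventually_realizable_def)
  have "realizable n (\<lambda>xi. [:character xi a, parity v0 a:] * F xi)" if "Suc m \<le> n" for n
    using that realizable_mult[OF a m, of "n - 1"] by (cases n) auto
  then show ?thesis by (auto simp: eventually_realizable_def)
qed

lemma eventually_realizable_coord_mult:
  assumes w: "w \<in> far_verts" and F: "eventually_realizable F"
  shows "eventually_realizable (\<lambda>xi. [:xi w:] * F xi)"
proof -
  have "w \<in> V" "w \<noteq> v0" using w by (auto simp: far_verts_def nbhd_def)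
  then show ?thesis
    using eventually_realizable_mult[OF gen_carrier F, of w] by (simp add: character_gen parity_gen)
qed

text \<open>
  Since \<open>xi w\<close> is idempotent, repeated commutators with \<open>w\<close> raise \<open>n\<close> and keep the coefficient.
\<close>
lemma eventually_realizable_coord:
  assumes w: "w \<in> far_verts"
  shows "eventually_realizable (\<lambda>xi. [:xi w:])"
proof -
  have wV: "w \<in> V" "w \<noteq> v0" using w by (auto simp: far_verts_def nbhd_def)
  have "realizable (Suc n) (\<lambda>xi. [:xi w:])" for n
  proof (induction n)
    case 0
    have "del xi (G.commutator (gen v0) (gen w)) $ 1 = [:xi w:]" if "xi \<in> far_chars" for xi
      using del_commutator_low(2)[OF that, of "gen v0" "gen w"] wV by (simp add: character_gen parity_gen)
    then show ?case
      using deep_commutator_1[of "gen v0" "gen w"] wV by (auto simp: realizable_def)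
  next
    case (Suc n)
    have square: "b * b = b" for b :: bit
      using bit_cases[of b] by auto
    show ?case
      using realizable_mult[OF gen_carrier Suc, of w] wV by (simp add: character_gen parity_gen square)
  qed
  then have "realizable n (\<lambda>xi. [:xi w:])" if "1 \<le> n" for n
    using that by (cases n) auto
  then show ?thesis by (auto simp: eventually_realizable_def)
qed

text \<open>
  The disjunction of Boolean values is the polynomial obtained by iterating \<open>x + y + x y\<close>. Over all far
  vertices it is 1 by the choice of \<open>far_chars\<close>.
\<close>
lemma eventually_realizable_one: "eventually_realizable (\<lambda>xi. 1)"
proof -
  have "eventually_realizable (\<lambda>xi. of_bool (\<exists>w\<in>S. xi w = 1))" if "finite S" "S \<subseteq> far_verts" for S
    using that
  proof (induction S)
    case empty
    then show ?case using eventually_realizable_zero by simp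
  next
    case (insert w S)
    let ?or = "\<lambda>xi :: 'a \<Rightarrow> bit. of_bool (\<exists>w\<in>S. xi w = 1) :: bit poly"
    have "eventually_realizable (\<lambda>xi. ?or xi + ([:xi w:] + [:xi w:] * ?or xi))"
      using insert by (intro eventually_realizable_add eventually_realizable_coord eventually_realizable_coord_mult) auto
    moreover have "?or xi + ([:xi w:] + [:xi w:] * ?or xi) = of_bool (\<exists>w\<in>insert w S. xi w = 1)" for xi
      using bit_cases[of "xi w"] by (auto simp: one_pCons numeral_poly)
    ultimately show ?case by simp
  qed
  from this[of far_verts] have "eventually_realizable (\<lambda>xi. of_bool (\<exists>w\<in>far_verts. xi w = 1))"
    by (simp add: far_verts_def)
  then show ?thesis
    by (subst (asm) eventually_realizable_cong[of _ "\<lambda>xi. 1"]) (auto simp: far_chars_def)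
qed

text \<open>
  The slope of \<open>v0\<close> is \<open>s\<close> or \<open>s + 1\<close>, depending on \<open>xi\<close>; the product \<open>s\<^sup>2 + s\<close> of the two does not depend
  on \<open>xi\<close>, and it is the sum of the slope and its square.
\<close>
lemma eventually_realizable_power: "eventually_realizable (\<lambda>xi. [:0, 1, 1:] ^ j)"
proof (induction j)
  case 0
  then show ?case using eventually_realizable_one by simp
next
  case (Suc j)
  let ?F = "\<lambda>xi :: 'a \<Rightarrow> bit. [:0, 1, 1:] ^ j :: bit poly"
  let ?c = "\<lambda>xi :: 'a \<Rightarrow> bit. [:xi v0, 1:] :: bit poly"
  have step: "eventually_realizable (\<lambda>xi. ?c xi * H xi)" if "eventually_realizable H" for H
    using eventually_realizable_mult[OF gen_carrier[OF v0] that] by (simp add: character_gen parity_gen)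
  have "eventually_realizable (\<lambda>xi. ?c xi * (?c xi * ?F xi) + ?c xi * ?F xi)"
    by (intro eventually_realizable_add step Suc)
  moreover have "?c xi * (?c xi * ?F xi) + ?c xi * ?F xi = (?c xi * ?c xi + ?c xi) * ?F xi" for xi
    by (simp only: algebra_simps)
  moreover have "?c xi * ?c xi + ?c xi = [:0, 1, 1:]" for xi
    using bit_cases[of "xi v0"] by auto
  ultimately show ?case by simp
qed

section \<open>Infinitely many twisted classes\<close>

definition truncation :: "nat \<Rightarrow> 'a word set \<Rightarrow> ('a \<Rightarrow> bit) \<times> nat \<Rightarrow> bit poly \<times> bit poly" where
  "truncation n g = (\<lambda>(xi, i)\<in>far_chars \<times> {..n}. (chi xi g $ i, del xi g $ i))"

lemma truncation_eq_iff:
  "truncation n g = truncation n h \<longleftrightarrow>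
     (\<forall>xi\<in>far_chars. \<forall>i\<le>n. chi xi g $ i = chi xi h $ i \<and> del xi g $ i = del xi h $ i)"
proof
  assume *: "truncation n g = truncation n h"
  show "\<forall>xi\<in>far_chars. \<forall>i\<le>n. chi xi g $ i = chi xi h $ i \<and> del xi g $ i = del xi h $ i"
  proof (intro ballI allI impI)
    fix xi i assume "xi \<in> far_chars" "i \<le> n"
    then show "chi xi g $ i = chi xi h $ i \<and> del xi g $ i = del xi h $ i"
      using fun_cong[OF *, of "(xi, i)"] by (simp add: truncation_def)
  qed
qed (auto simp: truncation_def fun_eq_iff restrict_def)

lemma finite_truncation: "finite (truncation n ` carrier G)"
proof (rule finite_subset)
  let ?P = "{p :: bit poly. degree p \<le> n}"
  have deg: "degree (chi xi g $ i) \<le> n \<and> degree (del xi g $ i) \<le> n"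
    if "xi \<in> far_chars" "i \<le> n" "g \<in> carrier G" for xi i g
  proof -
    have "degree (slope xi v) \<le> 1" for v by (simp add: slope_def)
    moreover have "degree (of_bool (v = v0) :: bit poly) = 0" for v by simp
    ultimately show ?thesis
      using affine_rep_coeff_degree_le[OF compatible_slope[OF that(1)] that(3)] that(2)
      unfolding coeff_degree_le_def by (meson order_trans)
  qed
  then show "truncation n ` carrier G \<subseteq> far_chars \<times> {..n} \<rightarrow>\<^sub>E ?P \<times> ?P"
    unfolding truncation_def by (intro image_subsetI, subst restrict_PiE_iff) auto
  show "finite (far_chars \<times> {..n} \<rightarrow>\<^sub>E ?P \<times> ?P)"
    using finite_far_chars finite_bit_poly_degree_le by (intro finite_PiE) auto
qed

lemma truncation_cong:
  assumes c: "a \<in> carrier G" "a' \<in> carrier G" "b \<in> carrier G" "b' \<in> carrier G"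
    and eq: "truncation n a = truncation n a'" "truncation n b = truncation n b'"
  shows "truncation n (a \<otimes>\<^bsub>G\<^esub> b) = truncation n (a' \<otimes>\<^bsub>G\<^esub> b')"
  unfolding truncation_eq_iff
proof (intro ballI allI impI)
  fix xi i assume xi: "xi \<in> far_chars" and i: "i \<le> n"
  have A: "chi xi a $ j = chi xi a' $ j" "del xi a $ j = del xi a' $ j"
    "chi xi b $ j = chi xi b' $ j" "del xi b $ j = del xi b' $ j" if "j \<le> n" for j
    using eq xi that by (auto simp: truncation_eq_iff)
  have "(chi xi a * H) $ i = (chi xi a' * H') $ i" if "\<And>j. j \<le> n \<Longrightarrow> H $ j = H' $ j" for H H'
    unfolding fps_mult_nth using A that i by (intro sum.cong) auto
  then show "chi xi (a \<otimes>\<^bsub>G\<^esub> b) $ i = chi xi (a' \<otimes>\<^bsub>G\<^esub> b') $ i \<and>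
      del xi (a \<otimes>\<^bsub>G\<^esub> b) $ i = del xi (a' \<otimes>\<^bsub>G\<^esub> b') $ i"
    using c A i by (simp add: affine_rep_mult[OF compatible_slope[OF xi]] affine_mult_def)
qed

text \<open>
  Take deep elements \<open>z j\<close> with the leading coefficients \<open>(s\<^sup>2 + s)\<^sup>j\<close> and a common \<open>n\<close>. The commutator
  of any element with \<open>z j\<close> is deep of order \<open>n + 1\<close>, so it is trivial in the quotient by \<open>K\<close>; this makes
  \<open>z j\<close> central there. It is fixed because its leading coefficient does not depend on \<open>xi\<close>.
\<close>
lemma reidemeister_number_raag_ge:
  assumes phi: "phi \<in> auto G"
  shows "enat J \<le> reidemeister_number G phi"
proof -
  let ?q = "[:0, 1, 1:] :: bit poly"
  have "\<forall>j. \<exists>m. \<forall>n\<ge>m. realizable n (\<lambda>xi. ?q ^ j)"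
    using eventually_realizable_power by (simp add: eventually_realizable_def)
  then obtain m where m: "\<And>j n. m j \<le> n \<Longrightarrow> realizable n (\<lambda>xi. ?q ^ j)" by metis
  \<comment> \<open>The sum is a convenient common upper bound of the thresholds.\<close>
  define n where "n = (\<Sum>j<J. m j)"
  have "realizable n (\<lambda>xi. ?q ^ j)" if "j < J" for j
    unfolding n_def using that by (intro m member_le_sum) auto
  then have "\<forall>j. \<exists>z. j < J \<longrightarrow> deep n z \<and> (\<forall>xi\<in>far_chars. del xi z $ n = ?q ^ j)"
    unfolding realizable_def by blast
  then obtain z where z: "\<And>j. j < J \<Longrightarrow> deep n (z j)"
    and lead: "\<And>j xi. j < J \<Longrightarrow> xi \<in> far_chars \<Longrightarrow> del xi (z j) $ n = ?q ^ j" by metis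
  have zc: "z j \<in> carrier G" if "j < J" for j using deep_carrier[OF z[OF that]] .
  define N where "N = {g \<in> carrier G. truncation n g = truncation n \<one>\<^bsub>G\<^esub>}"
  have N1: "N \<lhd> G" and N2: "finite (rcosets\<^bsub>G\<^esub> N)"
    by (rule G.finite_congruence_normal(1)[OF _ finite_truncation N_def]
        G.finite_congruence_normal(2)[OF _ finite_truncation N_def]; rule truncation_cong; assumption)+
  have N3: "a \<otimes>\<^bsub>G\<^esub> inv\<^bsub>G\<^esub> b \<in> N \<longleftrightarrow> truncation n a = truncation n b"
    if "a \<in> carrier G" "b \<in> carrier G" for a b
    by (rule G.finite_congruence_normal(3)[OF _ finite_truncation N_def that]; rule truncation_cong; assumption)
  define K where "K = {g \<in> carrier G. \<forall>f\<in>auto G. f g \<in> N}"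
  have gens: "finite (gen ` V)" "gen ` V \<subseteq> carrier G" by auto
  have K1: "K \<lhd> G" and K2: "finite (rcosets\<^bsub>G\<^esub> K)" and K3: "phi ` K \<subseteq> K"
    using G.finite_index_characteristic_core[OF gens generate_gen N1 N2 K_def] phi by blast+
  have KI: "g \<in> K" if "g \<in> carrier G" "\<And>f. f \<in> auto G \<Longrightarrow> f g \<in> N" for g
    using that unfolding K_def by blast
  have deep_K: "g \<in> K" if g: "deep (Suc n) g" for g
  proof (rule KI[OF deep_carrier[OF g]])
    fix f assume f: "f \<in> auto G"
    have "chi xi (f g) = 1 \<and> (\<forall>i\<le>n. del xi (f g) $ i = 0)" if "xi \<in> far_chars" for xi
      using g f that by (auto simp: deep_def)
    moreover have "rep xi \<one>\<^bsub>G\<^esub> = (1, 0)" if "xi \<in> far_chars" for xi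
      by (simp add: one_raag affine_rep_cls[OF compatible_slope[OF that]])
    ultimately show "f g \<in> N"
      using G.auto_hom_simps(1)[OF f deep_carrier[OF g]] by (simp add: N_def truncation_eq_iff)
  qed
  have "enat (card (z ` {..<J})) \<le> reidemeister_number G phi"
  proof (rule G.reidemeister_number_ge_card_central_fixed[OF _ K1 K2 K3])
    show "phi \<in> hom G G" using phi by (simp add: auto_def)
    show "z ` {..<J} \<subseteq> carrier G" using zc by auto
  next
    fix x y assume "x \<in> z ` {..<J}" "y \<in> z ` {..<J}" and K: "x \<otimes>\<^bsub>G\<^esub> inv\<^bsub>G\<^esub> y \<in> K"
    then obtain i j where ij: "i < J" "x = z i" "j < J" "y = z j" by auto
    have "x \<otimes>\<^bsub>G\<^esub> inv\<^bsub>G\<^esub> y \<in> carrier G" using ij zc by simp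
    then have "x \<otimes>\<^bsub>G\<^esub> inv\<^bsub>G\<^esub> y \<in> N" using K id_auto unfolding K_def by fastforce
    then have "truncation n x = truncation n y" using N3 ij zc by auto
    moreover obtain xi where "xi \<in> far_chars" using far_chars_nonempty by auto
    ultimately have "?q ^ i = ?q ^ j"
      using lead[of i xi] lead[of j xi] ij by (simp add: truncation_eq_iff)
    then have "degree (?q ^ i) = degree (?q ^ j)" by simp
    then have "i = j" by (simp add: degree_power_eq)
    then show "x = y" using ij by simp
  next
    fix x a assume x: "x \<in> z ` {..<J}" and a: "a \<in> carrier G"
    then have "deep (Suc n) (G.commutator a x)" using z deep_commutator_Suc by auto
    then show "a \<otimes>\<^bsub>G\<^esub> x \<otimes>\<^bsub>G\<^esub> inv\<^bsub>G\<^esub> a \<otimes>\<^bsub>G\<^esub> inv\<^bsub>G\<^esub> x \<in> K"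
      using deep_K by (simp add: G.commutator_def)
  next
    fix x assume "x \<in> z ` {..<J}"
    then obtain j where j: "j < J" "x = z j" by auto
    have x: "deep n x" "x \<in> carrier G" using z zc j by auto
    have px: "phi x \<in> carrier G" using G.auto_hom_simps(1)[OF phi x(2)] .
    show "phi x \<otimes>\<^bsub>G\<^esub> inv\<^bsub>G\<^esub> x \<in> K"
    proof (rule KI)
      fix f assume f: "f \<in> auto G"
      have fc: "f (phi x) \<in> carrier G" "f x \<in> carrier G" using G.auto_hom_simps(1)[OF f] px x by auto
      have fphi: "compose (carrier G) f phi \<in> auto G" by (rule G.auto_compose[OF f phi])
      have "chi xi (h x) = 1 \<and> (\<forall>i<n. del xi (h x) $ i = 0) \<and> del xi (h x) $ n = ?q ^ j"
        if "h \<in> auto G" "xi \<in> far_chars" for h xi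
        using x(1) that lead[OF j(1) pullback_far_chars[OF that]] by (auto simp: deep_def j(2))
      from this[OF f] this[OF fphi]
      have "truncation n (f (phi x)) = truncation n (f x)"
        using x(2) by (auto simp: truncation_eq_iff compose_def le_less)
      then show "f (phi x \<otimes>\<^bsub>G\<^esub> inv\<^bsub>G\<^esub> x) \<in> N"
        using N3 fc px x(2) by (simp add: G.auto_hom_simps[OF f])
    qed (use px x in simp)
  qed
  moreover have "inj_on z {..<J}"
  proof (rule inj_onI)
    fix i j assume ij: "i \<in> {..<J}" "j \<in> {..<J}" and eq: "z i = z j"
    obtain xi where "xi \<in> far_chars" using far_chars_nonempty by auto
    then have "?q ^ i = ?q ^ j" using lead[of i xi] lead[of j xi] ij eq by simp
    then have "degree (?q ^ i) = degree (?q ^ j)" by simp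
    then show "i = j" by (simp add: degree_power_eq)
  qed
  ultimately show ?thesis by (simp add: card_image)
qed

lemma R_infinity_raag: "R_infinity_property G"
  unfolding R_infinity_property_def
proof
  fix phi assume "phi \<in> auto G"
  then have ge: "enat J \<le> reidemeister_number G phi" for J by (rule reidemeister_number_raag_ge)
  show "reidemeister_number G phi = \<infinity>"
  proof (cases "reidemeister_number G phi")
    case (enat r)
    then show ?thesis using ge[of "Suc r"] by simp
  qed simp
qed

end

theorem proposition6p2p2:
  fixes \<Gamma> :: "('a, 'b) pre_digraph" and n d :: nat
  assumes "max_by_abelian n (n - 1) d \<Gamma>"
  shows "R_infinity_property (raag \<Gamma>)"
proof -
  have graph: "graph \<Gamma>" and nonreg: "\<not> regular_graph \<Gamma>"
    and n: "card (verts \<Gamma>) = n" "card (max_verts \<Gamma>) = n - 1"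
    using assms by (auto simp: max_by_abelian_def)
  interpret graph \<Gamma> by fact
  have sub: "max_verts \<Gamma> \<subseteq> verts \<Gamma>" by (auto simp: max_verts_def)
  have "verts \<Gamma> \<noteq> {}" using nonreg by (auto simp: regular_graph_def)
  then have "n > 0" using n by (auto simp: card_gt_0_iff)
  then have "card (verts \<Gamma> - max_verts \<Gamma>) = 1"
    using n sub by (simp add: card_Diff_subset finite_subset)
  then obtain v0 where v0: "verts \<Gamma> - max_verts \<Gamma> = {v0}" by (auto simp: card_1_singleton_iff)
  then have v0V: "v0 \<in> verts \<Gamma>" "v0 \<notin> max_verts \<Gamma>" by auto
  have "out_degree \<Gamma> v0 \<le> max_degree \<Gamma>" using v0V by (auto simp: max_degree_def)
  interpret raag_one_small \<Gamma> v0 "max_degree \<Gamma>"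
  proof
    show "v0 \<in> verts \<Gamma>" by fact
    show "out_degree \<Gamma> v0 < max_degree \<Gamma>"
      using v0V \<open>out_degree \<Gamma> v0 \<le> max_degree \<Gamma>\<close> by (auto simp: max_verts_def)
    show "out_degree \<Gamma> v = max_degree \<Gamma>" if "v \<in> verts \<Gamma>" "v \<noteq> v0" for v
    proof -
      have "v \<in> max_verts \<Gamma>" using v0 that by blast
      then show ?thesis by (simp add: max_verts_def)
    qed
    show "verts \<Gamma> \<noteq> {v0}" using nonreg by (auto simp: regular_graph_def)
  qed
  show ?thesis by (rule R_infinity_raag)
qed

end
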